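(* Let $J$ be a linearly ordered set and, for each $j\in J$, let $\mathcal{A}_j$ be a unital algebra with two states $\varphi_j,\psi_j$ and let $\widetilde{\mathcal{A}}_j=\mathcal{A}_j(P_j)$ be its extension, with extended states $\widetilde\varphi_j,\widetilde\psi_j$. Let $$\mathcal{A}=\bigotimes_{j\in J}(\widetilde{\mathcal{A}}_j\otimes\widetilde{\mathcal{A}}_j),\qquad \varphi=\bigotimes_{j\in J}(\widetilde\varphi_j\otimes\widetilde\psi_j),\qquad \psi=\bigotimes_{j\in J}(\widetilde\psi_j\otimes\widetilde\psi_j).$$ For $j\in J$ put $$p_j=\bigotimes_{k\ne j}(P_k\otimes P_k),\qquad p_j'=\bigotimes_{k<j}(1_k\otimes 1_k)\otimes\bigotimes_{k>j}(P_k\otimes P_k).$$ Then the family, indexed by $j\in J$, of the subalgebras of $\mathcal{A}$ generated by the elements of the form $$A_j=(a_j\otimes 1_j)\otimes p_j+(1_j\otimes a_j)\otimes(p_j'-p_j),\qquad a_j\in\mathcal{A}_j,$$ is c-monotone independent with respect to $(\varphi,\psi)$.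
   Context: Algebras are complex and unital, with $1_j$ the unit of $\mathcal{A}_j$. A state on a unital algebra is a linear functional taking the value $1$ at the unit (if the algebra is a $*$-algebra, it is also required to be positive). Subalgebras are not required to contain the unit of the ambient algebra. Extension. For a unital algebra $\mathcal{B}$ with state $\varphi$, $\widetilde{\mathcal{B}}=\mathcal{B}(P)$ is the unital algebra generated by $\mathcal{B}$ and an indeterminate $P$ subject to $1P=P1=P^2=P$, where $1$ is the unit of $\mathcal{B}$ (and $P^*=P$ in the $*$-case). The extended state $\widetilde\varphi:\widetilde{\mathcal{B}}\to\mathbb{C}$ is the linear functional determined by $\widetilde\varphi(P)=1$ and $$\widetilde\varphi(P^{\alpha}b_1Pb_2P\cdots Pb_nP^{\beta})=\varphi(b_1)\varphi(b_2)\cdots\varphi(b_n),\quad \alpha,\beta\in\{0,1\},\ b_1,\dots,b_n\in\mathcal{B}.$$ Tensor products. For each $j$ one uses the decomposition $\mathcal{A}=(\widetilde{\mathcal{A}}_j\otimes\widetilde{\mathcal{A}}_j)\otimes\bigotimes_{k\neq j}(\widetilde{\mathcal{A}}_k\otimes\widetilde{\mathcal{A}}_k)$; the order in which tensor factors are written is immaterial, since each factor is located by its index $j$ and by its position (first or second) in the pair $\widetilde{\mathcal{A}}_j\otimes\widetilde{\mathcal{A}}_j$. If $J$ is infinite, $\mathcal{A}$ is understood as the algebra, with componentwise multiplication, spanned by simple tensors $\bigotimes_{j}(x_j\otimes y_j)$ such that all but finitely many of the factors $x_j,y_j$ belong to $\{1_j,P_j\}$, and product states are evaluated on simple tensors as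 the product of the values on the factors (all but finitely many of which equal $1$). Monotone independence. Subalgebras $\{\mathcal{B}_j:j\in J\}$ of a unital algebra $\mathcal{B}$, $J$ linearly ordered, are monotone independent with respect to a state $\psi$ if $$\psi(b_1\cdots b_n)=\psi(b_i)\,\psi(b_1\cdots b_{i-1}b_{i+1}\cdots b_n)$$ whenever $b_k\in\mathcal{B}_{j_k}$, $j_1\neq j_2\neq\cdots\neq j_n$, and $j_{i-1}<j_i>j_{i+1}$, where for $i=1$ or $i=n$ only the right or left inequality, respectively, is required. c-monotone independence. Subalgebras $\{\mathcal{B}_j:j\in J\}$, $J$ linearly ordered, of a unital algebra with two states $\varphi,\psi$ are c-monotone independent with respect to $(\varphi,\psi)$ if they are monotone independent with respect to $\psi$ and $$\varphi(b_1\cdots b_n)=(\varphi(b_i)-\psi(b_i))\,\varphi(b_1\cdots b_{i-1})\,\varphi(b_{i+1}\cdots b_n)+\psi(b_i)\,\varphi(b_1\cdots b_{i-1}b_{i+1}\cdots b_n)$$ for any $b_k\in\mathcal{B}_{j_k}$ with $j_{i-1}<j_i>j_{i+1}$, where for $i=1$ or $i=n$ only the right or left inequality, respectively, is required, and states evaluated at empty products equal $1$. *)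

theory Defs
  imports Complex_Main "HOL-Algebra.Module" "HOL-Algebra.QuotRing"
begin

section \<open>Complex unital algebras, subalgebras and states\<close>

definition complex_ring :: "complex ring" where
  "complex_ring = \<lparr>carrier = UNIV, mult = (*), one = 1, zero = 0, add = (+)\<rparr>"

text \<open>The library locale \<^locale>\<open>algebra\<close> only covers commutative algebras.\<close>

locale complex_algebra = ring A + Module.module complex_ring A for A (structure) +
  assumes smult_mult_left:
      "x \<in> carrier A \<Longrightarrow> y \<in> carrier A \<Longrightarrow> (c \<odot> x) \<otimes>\<^bsub>A\<^esub> y = c \<odot> (x \<otimes>\<^bsub>A\<^esub> y)"
    and smult_mult_right:
      "x \<in> carrier A \<Longrightarrow> y \<in> carrier A \<Longrightarrow> x \<otimes>\<^bsub>A\<^esub> (c \<odot> y) = c \<odot> (x \<otimes>\<^bsub>A\<^esub> y)"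

text \<open>Subalgebras need not contain the unit of the ambient algebra.\<close>

definition complex_subalgebra :: "'a set \<Rightarrow> (complex, 'a, 'm) module_scheme \<Rightarrow> bool" where
  "complex_subalgebra B A \<longleftrightarrow> B \<subseteq> carrier A \<and> \<zero>\<^bsub>A\<^esub> \<in> B \<and>
     (\<forall>x\<in>B. \<forall>y\<in>B. x \<oplus>\<^bsub>A\<^esub> y \<in> B \<and> x \<otimes>\<^bsub>A\<^esub> y \<in> B) \<and>
     (\<forall>c. \<forall>x\<in>B. c \<odot>\<^bsub>A\<^esub> x \<in> B)"

definition generated_subalgebra :: "(complex, 'a, 'm) module_scheme \<Rightarrow> 'a set \<Rightarrow> 'a set" where
  "generated_subalgebra A S = \<Inter>{B. complex_subalgebra B A \<and> S \<subseteq> B}"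

definition linear_functional :: "(complex, 'a, 'm) module_scheme \<Rightarrow> ('a \<Rightarrow> complex) \<Rightarrow> bool" where
  "linear_functional A f \<longleftrightarrow>
     (\<forall>x\<in>carrier A. \<forall>y\<in>carrier A. f (x \<oplus>\<^bsub>A\<^esub> y) = f x + f y) \<and>
     (\<forall>c. \<forall>x\<in>carrier A. f (c \<odot>\<^bsub>A\<^esub> x) = c * f x)"

definition state :: "(complex, 'a, 'm) module_scheme \<Rightarrow> ('a \<Rightarrow> complex) \<Rightarrow> bool" where
  "state A f \<longleftrightarrow> linear_functional A f \<and> f \<one>\<^bsub>A\<^esub> = 1"

definition list_product :: "('a, 'm) monoid_scheme \<Rightarrow> 'a list \<Rightarrow> 'a" where
  "list_product A xs = foldr (\<lambda>x y. x \<otimes>\<^bsub>A\<^esub> y) xs \<one>\<^bsub>A\<^esub>"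


section \<open>Monotone and c-monotone independence\<close>

definition local_peak :: "'j::linorder list \<Rightarrow> nat \<Rightarrow> bool" where
  "local_peak js i \<longleftrightarrow> i < length js \<and> (0 < i \<longrightarrow> js ! (i - 1) < js ! i) \<and>
     (Suc i < length js \<longrightarrow> js ! i > js ! Suc i)"

text \<open>Positions are counted from 0: \<open>take i bs\<close> is the part of \<open>bs\<close> before the peak \<open>bs ! i\<close>,
  and \<open>drop (Suc i) bs\<close> the part after it.\<close>

definition monotone_independent ::
    "(complex, 'a, 'm) module_scheme \<Rightarrow> ('a \<Rightarrow> complex) \<Rightarrow> 'j::linorder set \<Rightarrow> ('j \<Rightarrow> 'a set) \<Rightarrow> bool"
  where
  "monotone_independent A \<psi> J B \<longleftrightarrow>
     complex_algebra A \<and> state A \<psi> \<and> (\<forall>j\<in>J. complex_subalgebra (B j) A) \<and>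
     (\<forall>js bs i. set js \<subseteq> J \<and> list_all2 (\<lambda>j b. b \<in> B j) js bs \<and> distinct_adj js \<and>
        local_peak js i \<longrightarrow>
        \<psi> (list_product A bs)
          = \<psi> (bs ! i) * \<psi> (list_product A (take i bs @ drop (Suc i) bs)))"

definition c_monotone_independent ::
    "(complex, 'a, 'm) module_scheme \<Rightarrow> ('a \<Rightarrow> complex) \<Rightarrow> ('a \<Rightarrow> complex) \<Rightarrow>
     'j::linorder set \<Rightarrow> ('j \<Rightarrow> 'a set) \<Rightarrow> bool" where
  "c_monotone_independent A \<phi> \<psi> J B \<longleftrightarrow>
     monotone_independent A \<psi> J B \<and> state A \<phi> \<and>
     (\<forall>js bs i. set js \<subseteq> J \<and> list_all2 (\<lambda>j b. b \<in> B j) js bs \<and> local_peak js i \<longrightarrow>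
        \<phi> (list_product A bs)
          = (\<phi> (bs ! i) - \<psi> (bs ! i)) * \<phi> (list_product A (take i bs))
              * \<phi> (list_product A (drop (Suc i) bs))
            + \<psi> (bs ! i) * \<phi> (list_product A (take i bs @ drop (Suc i) bs)))"


section \<open>Monoid algebras and quotients by relations\<close>

definition monoid_algebra :: "('w, 'm) monoid_scheme \<Rightarrow> (complex, 'w \<Rightarrow> complex) module" where
  "monoid_algebra M =
     \<lparr>carrier = {f. {w. f w \<noteq> 0} \<subseteq> carrier M \<and> finite {w. f w \<noteq> 0}},
      mult = (\<lambda>f g w. \<Sum>(u, v) | f u \<noteq> 0 \<and> g v \<noteq> 0 \<and> u \<otimes>\<^bsub>M\<^esub> v = w. f u * g v),
      one = (\<lambda>w. if w = \<one>\<^bsub>M\<^esub> then 1 else 0),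
      zero = (\<lambda>w. 0),
      add = (\<lambda>f g w. f w + g w),
      smult = (\<lambda>c f w. c * f w)\<rparr>"

definition basis :: "'w \<Rightarrow> 'w \<Rightarrow> complex" where
  "basis w = (\<lambda>v. if v = w then 1 else 0)"

definition quotient_algebra ::
    "(complex, 'a, 'm) module_scheme \<Rightarrow> 'a set \<Rightarrow> (complex, 'a set) module" where
  "quotient_algebra A I =
     \<lparr>carrier = carrier (A Quot I), mult = mult (A Quot I), one = one (A Quot I),
      zero = zero (A Quot I), add = add (A Quot I),
      smult = (\<lambda>c X. \<Union>x\<in>X. I +>\<^bsub>A\<^esub> (c \<odot>\<^bsub>A\<^esub> x))\<rparr>"

definition relation_ideal :: "(complex, 'a, 'm) module_scheme \<Rightarrow> ('a \<times> 'a) set \<Rightarrow> 'a set" where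
  "relation_ideal A R = Idl\<^bsub>A\<^esub> {u \<ominus>\<^bsub>A\<^esub> v | u v. (u, v) \<in> R}"


section \<open>The extension by an idempotent\<close>

datatype 'a letter = Elem 'a | Proj

definition word_monoid :: "('a, 'm) monoid_scheme \<Rightarrow> 'a letter list monoid" where
  "word_monoid B = \<lparr>carrier = lists (insert Proj (Elem ` carrier B)), mult = (@), one = []\<rparr>"

text \<open>
  The monoid algebra of \<open>word_monoid B\<close> is the free unital algebra on the set
  \<open>carrier B \<union> {P}\<close>. The first three families of relations make \<open>Elem\<close> linear and multiplicative,
  the fourth identifies the unit of \<open>B\<close> with the unit of the extension (so that \<open>1P = P1 = P\<close>),
  and the last is \<open>P\<^sup>2 = P\<close>.
\<close>

definition extension_relations ::
    "(complex, 'a, 'm) module_scheme \<Rightarrow>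
     (('a letter list \<Rightarrow> complex) \<times> ('a letter list \<Rightarrow> complex)) set" where
  "extension_relations B =
     (let F = monoid_algebra (word_monoid B) in
      {(basis [Elem (x \<oplus>\<^bsub>B\<^esub> y)], basis [Elem x] \<oplus>\<^bsub>F\<^esub> basis [Elem y]) | x y.
          x \<in> carrier B \<and> y \<in> carrier B} \<union>
      {(basis [Elem (c \<odot>\<^bsub>B\<^esub> x)], c \<odot>\<^bsub>F\<^esub> basis [Elem x]) | c x. x \<in> carrier B} \<union>
      {(basis [Elem (x \<otimes>\<^bsub>B\<^esub> y)], basis [Elem x, Elem y]) | x y.
          x \<in> carrier B \<and> y \<in> carrier B} \<union>
      {(basis [Elem \<one>\<^bsub>B\<^esub>], basis [])} \<union>
      {(basis [Proj, Proj], basis [Proj])})"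

definition extension_ideal ::
    "(complex, 'a, 'm) module_scheme \<Rightarrow> ('a letter list \<Rightarrow> complex) set" where
  "extension_ideal B = relation_ideal (monoid_algebra (word_monoid B)) (extension_relations B)"

definition extension ::
    "(complex, 'a, 'm) module_scheme \<Rightarrow> (complex, ('a letter list \<Rightarrow> complex) set) module" where
  "extension B = quotient_algebra (monoid_algebra (word_monoid B)) (extension_ideal B)"

definition ext_emb ::
    "(complex, 'a, 'm) module_scheme \<Rightarrow> 'a \<Rightarrow> ('a letter list \<Rightarrow> complex) set" where
  "ext_emb B b = extension_ideal B +>\<^bsub>monoid_algebra (word_monoid B)\<^esub> basis [Elem b]"

definition ext_P ::
    "(complex, 'a, 'm) module_scheme \<Rightarrow> ('a letter list \<Rightarrow> complex) set" where
  "ext_P B = extension_ideal B +>\<^bsub>monoid_algebra (word_monoid B)\<^esub> basis [Proj]"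

fun interleave :: "'a \<Rightarrow> 'a list \<Rightarrow> 'a list" where
  "interleave p (x # y # xs) = x # p # interleave p (y # xs)"
| "interleave p xs = xs"

text \<open>
  The alternating words below and \<open>P\<close> span the extension, so the functional is unique on
  the carrier.
\<close>

definition extended_state ::
    "(complex, 'a, 'm) module_scheme \<Rightarrow> ('a \<Rightarrow> complex) \<Rightarrow>
     ('a letter list \<Rightarrow> complex) set \<Rightarrow> complex" where
  "extended_state B \<phi> = (SOME f. linear_functional (extension B) f \<and> f (ext_P B) = 1 \<and>
     (\<forall>\<alpha>\<in>{0, 1}. \<forall>\<beta>\<in>{0, 1}. \<forall>bs. bs \<noteq> [] \<and> set bs \<subseteq> carrier B \<longrightarrow>
        f (list_product (extension B)
             (replicate \<alpha> (ext_P B) @ interleave (ext_P B) (map (ext_emb B) bs)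
                @ replicate \<beta> (ext_P B)))
          = prod_list (map \<phi> bs)))"


section \<open>Restricted tensor products of algebras\<close>

text \<open>
  For algebras \<open>T i\<close>, \<open>i \<in> I\<close>, and multiplicatively closed sets \<open>E i\<close> containing the unit, the
  restricted tensor product is spanned by simple tensors \<open>\<Otimes>\<^sub>i x\<^sub>i\<close> with \<open>x\<^sub>i \<in> E i\<close> for all but
  finitely many \<open>i\<close>. The monoid algebra of the monoid of such families is the free vector space on
  them, with componentwise multiplication of basis elements. The linear span of the
  multilinearity relations is already an ideal in it, so the quotient is, as a vector space, the
  usual tensor product.
\<close>

definition tensor_monoid ::
    "'i set \<Rightarrow> ('i \<Rightarrow> (complex, 'b) module) \<Rightarrow> ('i \<Rightarrow> 'b set) \<Rightarrow> ('i \<Rightarrow> 'b) monoid" where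
  "tensor_monoid I T E =
     \<lparr>carrier = {x \<in> (\<Pi>\<^sub>E i\<in>I. carrier (T i)). finite {i \<in> I. x i \<notin> E i}},
      mult = (\<lambda>x y. \<lambda>i\<in>I. x i \<otimes>\<^bsub>T i\<^esub> y i),
      one = (\<lambda>i\<in>I. \<one>\<^bsub>T i\<^esub>)\<rparr>"

definition tensor_relations ::
    "'i set \<Rightarrow> ('i \<Rightarrow> (complex, 'b) module) \<Rightarrow> ('i \<Rightarrow> 'b set) \<Rightarrow>
     ((('i \<Rightarrow> 'b) \<Rightarrow> complex) \<times> (('i \<Rightarrow> 'b) \<Rightarrow> complex)) set" where
  "tensor_relations I T E =
     (let F = monoid_algebra (tensor_monoid I T E) in
      {(basis (x(i := u \<oplus>\<^bsub>T i\<^esub> v)), basis (x(i := u)) \<oplus>\<^bsub>F\<^esub> basis (x(i := v))) | x i u v.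
          x \<in> carrier (tensor_monoid I T E) \<and> i \<in> I \<and> u \<in> carrier (T i) \<and> v \<in> carrier (T i)} \<union>
      {(basis (x(i := c \<odot>\<^bsub>T i\<^esub> u)), c \<odot>\<^bsub>F\<^esub> basis (x(i := u))) | x i c u.
          x \<in> carrier (tensor_monoid I T E) \<and> i \<in> I \<and> u \<in> carrier (T i)})"

definition tensor_ideal ::
    "'i set \<Rightarrow> ('i \<Rightarrow> (complex, 'b) module) \<Rightarrow> ('i \<Rightarrow> 'b set) \<Rightarrow> (('i \<Rightarrow> 'b) \<Rightarrow> complex) set" where
  "tensor_ideal I T E =
     relation_ideal (monoid_algebra (tensor_monoid I T E)) (tensor_relations I T E)"

definition tensor_algebra ::
    "'i set \<Rightarrow> ('i \<Rightarrow> (complex, 'b) module) \<Rightarrow> ('i \<Rightarrow> 'b set) \<Rightarrow>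
     (complex, (('i \<Rightarrow> 'b) \<Rightarrow> complex) set) module" where
  "tensor_algebra I T E =
     quotient_algebra (monoid_algebra (tensor_monoid I T E)) (tensor_ideal I T E)"

definition simple_tensor ::
    "'i set \<Rightarrow> ('i \<Rightarrow> (complex, 'b) module) \<Rightarrow> ('i \<Rightarrow> 'b set) \<Rightarrow> ('i \<Rightarrow> 'b) \<Rightarrow>
     (('i \<Rightarrow> 'b) \<Rightarrow> complex) set" where
  "simple_tensor I T E x =
     tensor_ideal I T E +>\<^bsub>monoid_algebra (tensor_monoid I T E)\<^esub> basis (restrict x I)"

text \<open>
  It is meant for functionals \<open>f i\<close> equal to 1 on \<open>E i\<close>, so that only finitely many factors differ
  from 1; the product is over those factors because \<^const>\<open>prod\<close> is constantly 1 on infinite sets.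
  The functional is unique on the carrier because simple tensors span.
\<close>

definition product_state ::
    "'i set \<Rightarrow> ('i \<Rightarrow> (complex, 'b) module) \<Rightarrow> ('i \<Rightarrow> 'b set) \<Rightarrow> ('i \<Rightarrow> 'b \<Rightarrow> complex) \<Rightarrow>
     (('i \<Rightarrow> 'b) \<Rightarrow> complex) set \<Rightarrow> complex" where
  "product_state I T E f = (SOME F. linear_functional (tensor_algebra I T E) F \<and>
     (\<forall>x\<in>carrier (tensor_monoid I T E).
        F (simple_tensor I T E x) = (\<Prod>i | i \<in> I \<and> f i (x i) \<noteq> 1. f i (x i))))"


section \<open>The tensor product of the doubled extensions\<close>

text \<open>
  A tensor factor is located by its index \<open>j\<close> and its position in the pair
  \<open>\<A>~\<^sub>j \<otimes> \<A>~\<^sub>j\<close>.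
\<close>

datatype position = First | Second

definition factor_set :: "'j set \<Rightarrow> ('j \<times> position) set" where
  "factor_set J = J \<times> UNIV"

definition factor_algebra ::
    "('j \<Rightarrow> (complex, 'a) module) \<Rightarrow> 'j \<times> position \<Rightarrow>
     (complex, ('a letter list \<Rightarrow> complex) set) module" where
  "factor_algebra A = (\<lambda>(j, s). extension (A j))"

definition factor_base ::
    "('j \<Rightarrow> (complex, 'a) module) \<Rightarrow> 'j \<times> position \<Rightarrow> ('a letter list \<Rightarrow> complex) set set" where
  "factor_base A = (\<lambda>(j, s). {\<one>\<^bsub>extension (A j)\<^esub>, ext_P (A j)})"

type_synonym ('j, 'a) big =
  "(('j \<times> position \<Rightarrow> ('a letter list \<Rightarrow> complex) set) \<Rightarrow> complex) set"

definition big_algebra ::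
    "'j set \<Rightarrow> ('j \<Rightarrow> (complex, 'a) module) \<Rightarrow> (complex, ('j, 'a) big) module" where
  "big_algebra J A = tensor_algebra (factor_set J) (factor_algebra A) (factor_base A)"

text \<open>\<open>big_state J A \<chi> \<omega>\<close> is the product state \<open>\<Otimes>\<^sub>j (\<chi>~\<^sub>j \<otimes> \<omega>~\<^sub>j)\<close>.\<close>

definition big_state ::
    "'j set \<Rightarrow> ('j \<Rightarrow> (complex, 'a) module) \<Rightarrow> ('j \<Rightarrow> 'a \<Rightarrow> complex) \<Rightarrow> ('j \<Rightarrow> 'a \<Rightarrow> complex) \<Rightarrow>
     ('j, 'a) big \<Rightarrow> complex" where
  "big_state J A \<chi> \<omega> =
     product_state (factor_set J) (factor_algebra A) (factor_base A)
       (\<lambda>(j, s). case s of First \<Rightarrow> extended_state (A j) (\<chi> j)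
                         | Second \<Rightarrow> extended_state (A j) (\<omega> j))"

text \<open>\<open>site_tensor J A j u v w\<close> is \<open>(u \<otimes> v) \<otimes> \<Otimes>\<^bsub>k \<noteq> j\<^esub> (w\<^sub>k \<otimes> w\<^sub>k)\<close> with \<open>u \<otimes> v\<close> at index \<open>j\<close>.\<close>

definition site_tensor ::
    "'j set \<Rightarrow> ('j \<Rightarrow> (complex, 'a) module) \<Rightarrow> 'j \<Rightarrow> ('a letter list \<Rightarrow> complex) set \<Rightarrow>
     ('a letter list \<Rightarrow> complex) set \<Rightarrow> ('j \<Rightarrow> ('a letter list \<Rightarrow> complex) set) \<Rightarrow> ('j, 'a) big" where
  "site_tensor J A j u v w =
     simple_tensor (factor_set J) (factor_algebra A) (factor_base A)
       (\<lambda>(k, s). if k = j then (case s of First \<Rightarrow> u | Second \<Rightarrow> v) else w k)"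

definition p_factors ::
    "('j \<Rightarrow> (complex, 'a) module) \<Rightarrow> 'j \<Rightarrow> ('a letter list \<Rightarrow> complex) set" where
  "p_factors A k = ext_P (A k)"

definition p'_factors ::
    "('j::linorder \<Rightarrow> (complex, 'a) module) \<Rightarrow> 'j \<Rightarrow> 'j \<Rightarrow> ('a letter list \<Rightarrow> complex) set" where
  "p'_factors A j k = (if k < j then \<one>\<^bsub>extension (A k)\<^esub> else ext_P (A k))"

text \<open>
  The element \<open>(a \<otimes> 1) \<otimes> p\<^sub>j + (1 \<otimes> a) \<otimes> (p'\<^sub>j - p\<^sub>j)\<close>, where \<open>(1 \<otimes> a) \<otimes> (p'\<^sub>j - p\<^sub>j)\<close>
  is written as \<open>(1 \<otimes> a) \<otimes> p'\<^sub>j - (1 \<otimes> a) \<otimes> p\<^sub>j\<close>.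
\<close>

definition replica ::
    "'j::linorder set \<Rightarrow> ('j \<Rightarrow> (complex, 'a) module) \<Rightarrow> 'j \<Rightarrow> 'a \<Rightarrow> ('j, 'a) big" where
  "replica J A j a =
     site_tensor J A j (ext_emb (A j) a) \<one>\<^bsub>extension (A j)\<^esub> (p_factors A)
     \<oplus>\<^bsub>big_algebra J A\<^esub>
     (site_tensor J A j \<one>\<^bsub>extension (A j)\<^esub> (ext_emb (A j) a) (p'_factors A j)
      \<ominus>\<^bsub>big_algebra J A\<^esub>
      site_tensor J A j \<one>\<^bsub>extension (A j)\<^esub> (ext_emb (A j) a) (p_factors A))"

end

theory Submission
  imports Defs
begin

text \<open>
  The subalgebras in question are small: \<open>p\<^sub>j\<close> and \<open>p'\<^sub>j - p\<^sub>j\<close> are orthogonal idempotents, so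
  \<open>a \<mapsto> A\<^sub>j(a)\<close> is linear and multiplicative, and the replicas of index \<open>j\<close> already form a subalgebra
  (\<open>replica_subalgebra\<close>). Independence is therefore a statement about products of replicas.

  Let \<open>E\<^sub>k\<close> (called \<open>cut\<close> below) be the simple tensor with the unit at all indices below \<open>k\<close> and \<open>P\<close>
  from \<open>k\<close> on. For \<open>j < k\<close> the replica \<open>A\<^sub>j(b)\<close> carries \<open>P\<close> at all indices from \<open>k\<close> on, so
  \<open>A\<^sub>j(b) E\<^sub>k = A\<^sub>j(b) = E\<^sub>k A\<^sub>j(b)\<close> (\<open>replica_cut\<close>), and product states do not notice a factor \<open>E\<^sub>k\<close>
  at the ends of a product (\<open>state_cut\<close>). Hence at a peak of index \<open>k\<close> the replica \<open>A\<^sub>k(a)\<close> may be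
  replaced by its compression \<open>E\<^sub>k A\<^sub>k(a) E\<^sub>k\<close>.

  Compressions are computable because an extended state factorizes at \<open>P\<close>, that is,
  \<open>\<phi>~(x P y) = \<phi>~(x) \<phi>~(y)\<close> (\<open>extended_state_P_between\<close>), so that \<open>\<phi>~(x P a P y) = \<phi>(a) \<phi>~(x P y)\<close>.
  The term \<open>(a \<otimes> 1) \<otimes> p\<^sub>k\<close> thus contributes \<open>\<phi>\<^sub>k(a)\<close> times the tensor with \<open>P\<close> in all factors, at which
  the product state splits. The term \<open>(1 \<otimes> a) \<otimes> p'\<^sub>k\<close> contributes \<open>\<psi>\<^sub>k(a)\<close> times \<open>E\<^sub>k\<close>, which the
  neighbours absorb, and the subtracted term \<open>(1 \<otimes> a) \<otimes> p\<^sub>k\<close> contributes \<open>\<psi>\<^sub>k(a)\<close> times the tensor with \<open>P\<close> in all factors.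
  For the product \<open>x\<close> before and the product \<open>y\<close> after the peak this gives
  \<open>\<phi>(x A\<^sub>k(a) y) = (\<phi>\<^sub>k(a) - \<psi>\<^sub>k(a)) \<phi>(x) \<phi>(y) + \<psi>\<^sub>k(a) \<phi>(x y)\<close> (\<open>state_peak_product\<close>), which is the
  formula for c-monotone independence since \<open>\<phi>(A\<^sub>k(a)) = \<phi>\<^sub>k(a)\<close> and \<open>\<psi>(A\<^sub>k(a)) = \<psi>\<^sub>k(a)\<close>.
  Monotone independence with respect to \<open>\<psi>\<close> is the same formula for \<open>\<phi>\<^sub>k = \<psi>\<^sub>k\<close>, where the first
  term vanishes.

  The states are chosen among functionals with prescribed values, so their existence has to be
  proved. Both the extension and the tensor product are quotients of monoid algebras by relations,
  and a function on the monoid descends to such a quotient if it respects the relations in all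
  two-sided contexts (\<open>functional_exists\<close>). For the extended state the function comes from a
  representation on the algebra in which \<open>P\<close> acts as a rank-one projection; for the product state it
  is the product of the values of the factors.
\<close>

section \<open>Complex algebras and their functionals\<close>

lemma complex_ring_simps [simp]:
  "carrier complex_ring = UNIV" "x \<otimes>\<^bsub>complex_ring\<^esub> y = x * y" "\<one>\<^bsub>complex_ring\<^esub> = 1"
  "\<zero>\<^bsub>complex_ring\<^esub> = 0" "x \<oplus>\<^bsub>complex_ring\<^esub> y = x + y"
  by (simp_all add: complex_ring_def)

lemma cring_complex_ring: "cring complex_ring"
proof (rule cringI)
  show "abelian_group complex_ring"
  proof (rule abelian_groupI)
    fix x :: complex
    have "- x + x = 0" by simp
    then show "\<exists>y\<in>carrier complex_ring. y \<oplus>\<^bsub>complex_ring\<^esub> x = \<zero>\<^bsub>complex_ring\<^esub>"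
      by (auto intro: exI[of _ "- x"])
  qed (auto simp: algebra_simps)
  show "comm_monoid complex_ring"
    by (rule comm_monoidI) (auto simp: algebra_simps)
qed (auto simp: algebra_simps)

text \<open>
  In \<^locale>\<open>complex_algebra\<close> the short names of ring facts refer to the scalars
  \<^const>\<open>complex_ring\<close>. The equivalent locale below has the ring \<open>A\<close> as its only ring, and
  scalars that range over a type.
\<close>

locale ring_over_complex = ring A for A :: "(complex, 'a, 'm) module_scheme" (structure) +
  assumes scale_closed [simp, intro]: "x \<in> carrier A \<Longrightarrow> c \<odot> x \<in> carrier A"
    and scale_distrib_left: "x \<in> carrier A \<Longrightarrow> (c + d) \<odot> x = c \<odot> x \<oplus> d \<odot> x"
    and scale_distrib_right:
      "x \<in> carrier A \<Longrightarrow> y \<in> carrier A \<Longrightarrow> c \<odot> (x \<oplus> y) = c \<odot> x \<oplus> c \<odot> y"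
    and scale_scale: "x \<in> carrier A \<Longrightarrow> c \<odot> (d \<odot> x) = (c * d) \<odot> x"
    and scale_one: "x \<in> carrier A \<Longrightarrow> 1 \<odot> x = x"
    and scale_mult_left:
      "x \<in> carrier A \<Longrightarrow> y \<in> carrier A \<Longrightarrow> (c \<odot> x) \<otimes> y = c \<odot> (x \<otimes> y)"
    and scale_mult_right:
      "x \<in> carrier A \<Longrightarrow> y \<in> carrier A \<Longrightarrow> x \<otimes> (c \<odot> y) = c \<odot> (x \<otimes> y)"

lemma complex_algebra_iff: "complex_algebra A \<longleftrightarrow> ring_over_complex A"
proof
  assume "complex_algebra A"
  then interpret A: complex_algebra A .
  have "ring A"
    using \<open>complex_algebra A\<close> by (rule complex_algebra.axioms)
  moreover have "ring_over_complex_axioms A"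
  proof
    fix x y c d assume x: "x \<in> carrier A" and y: "y \<in> carrier A"
    show "c \<odot>\<^bsub>A\<^esub> x \<in> carrier A" using x A.smult_closed[of c x] by simp
    show "(c + d) \<odot>\<^bsub>A\<^esub> x = c \<odot>\<^bsub>A\<^esub> x \<oplus>\<^bsub>A\<^esub> d \<odot>\<^bsub>A\<^esub> x" using x A.smult_l_distr[of c d x] by simp
    show "c \<odot>\<^bsub>A\<^esub> (x \<oplus>\<^bsub>A\<^esub> y) = c \<odot>\<^bsub>A\<^esub> x \<oplus>\<^bsub>A\<^esub> c \<odot>\<^bsub>A\<^esub> y" using x y A.smult_r_distr[of c x y] by simp
    show "c \<odot>\<^bsub>A\<^esub> (d \<odot>\<^bsub>A\<^esub> x) = (c * d) \<odot>\<^bsub>A\<^esub> x" using x A.smult_assoc1[of c d x] by simp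
    show "1 \<odot>\<^bsub>A\<^esub> x = x" using x A.smult_one[of x] by simp
    show "(c \<odot>\<^bsub>A\<^esub> x) \<otimes>\<^bsub>A\<^esub> y = c \<odot>\<^bsub>A\<^esub> (x \<otimes>\<^bsub>A\<^esub> y)" using x y by (rule A.smult_mult_left)
    show "x \<otimes>\<^bsub>A\<^esub> (c \<odot>\<^bsub>A\<^esub> y) = c \<odot>\<^bsub>A\<^esub> (x \<otimes>\<^bsub>A\<^esub> y)" using x y by (rule A.smult_mult_right)
  qed
  ultimately show "ring_over_complex A" by (rule ring_over_complex.intro)
next
  assume "ring_over_complex A"
  then interpret A: ring_over_complex A .
  have "Module.module complex_ring A"
    by (rule moduleI)
      (auto simp: cring_complex_ring A.abelian_group_axioms A.scale_distrib_left
        A.scale_distrib_right A.scale_scale A.scale_one)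
  then show "complex_algebra A"
    by (intro complex_algebra.intro complex_algebra_axioms.intro A.ring_axioms)
      (auto simp: A.scale_mult_left A.scale_mult_right)
qed

context ring_over_complex
begin

lemma scale_zero: "x \<in> carrier A \<Longrightarrow> 0 \<odot> x = \<zero>\<^bsub>A\<^esub>"
proof -
  assume x: "x \<in> carrier A"
  then have "0 \<odot> x = 0 \<odot> x \<oplus> 0 \<odot> x"
    using scale_distrib_left[of x 0 0] by simp
  then show ?thesis using x add.l_cancel_one'[of "0 \<odot> x" "0 \<odot> x"] by simp
qed

lemma minus_eq_scale: "x \<in> carrier A \<Longrightarrow> \<ominus>\<^bsub>A\<^esub> x = (- 1) \<odot> x"
proof -
  assume x: "x \<in> carrier A"
  have "x \<oplus>\<^bsub>A\<^esub> (- 1) \<odot> x = (1 + (- 1)) \<odot> x"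
    using x by (simp only: scale_distrib_left scale_one)
  also have "\<dots> = \<zero>\<^bsub>A\<^esub>" using x by (simp add: scale_zero)
  finally have "(- 1) \<odot> x \<oplus>\<^bsub>A\<^esub> x = \<zero>\<^bsub>A\<^esub>" using x by (simp add: a_comm)
  then show ?thesis using x by (intro minus_equality) auto
qed

lemma diff_eq_scale:
  "x \<in> carrier A \<Longrightarrow> y \<in> carrier A \<Longrightarrow> x \<ominus>\<^bsub>A\<^esub> y = x \<oplus>\<^bsub>A\<^esub> (- 1) \<odot> y"
  by (simp add: a_minus_def minus_eq_scale)

lemma linear_functional_diff:
  assumes "linear_functional A f" "x \<in> carrier A" "y \<in> carrier A"
  shows "f (x \<ominus>\<^bsub>A\<^esub> y) = f x - f y"
  using assms by (simp add: linear_functional_def diff_eq_scale)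

lemma linear_functional_zero: "linear_functional A f \<Longrightarrow> f \<zero>\<^bsub>A\<^esub> = 0"
  using linear_functional_diff[of f "\<zero>\<^bsub>A\<^esub>" "\<zero>\<^bsub>A\<^esub>"] by (simp add: a_minus_def)

lemma linear_functional_sandwich:
  assumes f: "linear_functional A f" and "c \<in> carrier A" "y \<in> carrier A"
  shows "linear_functional A (\<lambda>x. f (x \<otimes> c \<otimes> y))" "linear_functional A (\<lambda>x. f (y \<otimes> c \<otimes> x))"
  using assms
  by (auto simp: linear_functional_def l_distr r_distr scale_mult_left scale_mult_right)

lemma list_product_closed [simp, intro]:
  "set xs \<subseteq> carrier A \<Longrightarrow> list_product A xs \<in> carrier A"
  by (induction xs) (auto simp: list_product_def)

lemma list_product_append:
  "set xs \<subseteq> carrier A \<Longrightarrow> set ys \<subseteq> carrier A \<Longrightarrow>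
    list_product A (xs @ ys) = list_product A xs \<otimes>\<^bsub>A\<^esub> list_product A ys"
proof (induction xs)
  case Nil
  then show ?case using list_product_closed[of ys] by (simp add: list_product_def)
next
  case (Cons x xs)
  then have "list_product A (x # xs @ ys) = x \<otimes>\<^bsub>A\<^esub> (list_product A xs \<otimes>\<^bsub>A\<^esub> list_product A ys)"
    by (simp add: list_product_def)
  then show ?case
    using Cons.prems list_product_closed[of xs] list_product_closed[of ys]
    by (simp add: list_product_def m_assoc)
qed

end

lemma list_product_simps [simp]:
  "list_product A [] = \<one>\<^bsub>A\<^esub>" "list_product A (x # xs) = x \<otimes>\<^bsub>A\<^esub> list_product A xs"
  by (simp_all add: list_product_def)

lemma linear_functionalD:
  assumes "linear_functional A f"
  shows "x \<in> carrier A \<Longrightarrow> y \<in> carrier A \<Longrightarrow> f (x \<oplus>\<^bsub>A\<^esub> y) = f x + f y"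
    and "x \<in> carrier A \<Longrightarrow> f (c \<odot>\<^bsub>A\<^esub> x) = c * f x"
  using assms by (auto simp: linear_functional_def)

section \<open>Quotients of complex algebras\<close>

locale algebra_quotient = ring_over_complex A + ideal I A for A (structure) and I
begin

abbreviation Q where "Q \<equiv> quotient_algebra A I"
abbreviation proj where "proj x \<equiv> I +>\<^bsub>A\<^esub> x"

text \<open>
  A ring ideal of a unital algebra is a subspace, since \<open>c x = (c 1) x\<close>.
\<close>

lemma ideal_scale: "x \<in> I \<Longrightarrow> c \<odot> x \<in> I"
proof -
  assume x: "x \<in> I"
  then have "c \<odot> x = (c \<odot> \<one>\<^bsub>A\<^esub>) \<otimes>\<^bsub>A\<^esub> x"
    using a_Hcarr by (simp add: scale_mult_left)
  then show ?thesis using x by (simp add: I_l_closed)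
qed

lemma quotient_carrier: "carrier Q = proj ` carrier A"
  by (auto simp: quotient_algebra_def FactRing_simps)

lemma proj_closed [simp, intro]: "x \<in> carrier A \<Longrightarrow> proj x \<in> carrier Q"
  by (simp add: quotient_carrier)

lemma proj_eq_iff:
  assumes "x \<in> carrier A" "y \<in> carrier A"
  shows "proj x = proj y \<longleftrightarrow> x \<ominus>\<^bsub>A\<^esub> y \<in> I"
  using quotient_eq_iff_same_a_r_cos[OF is_ideal assms] by simp

lemma proj_ops:
  assumes "x \<in> carrier A" "y \<in> carrier A"
  shows "proj x \<oplus>\<^bsub>Q\<^esub> proj y = proj (x \<oplus>\<^bsub>A\<^esub> y)" "proj x \<otimes>\<^bsub>Q\<^esub> proj y = proj (x \<otimes>\<^bsub>A\<^esub> y)"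
  using assms by (simp_all add: quotient_algebra_def FactRing_simps rcoset_mult_add a_rcos_sum)

lemma proj_one: "\<one>\<^bsub>Q\<^esub> = proj \<one>\<^bsub>A\<^esub>"
  by (simp add: quotient_algebra_def FactRing_simps)

text \<open>
  The scalar multiple of a coset is defined as a union over its members; all of them give the same
  coset because the ideal is closed under scalars.
\<close>

lemma proj_scale:
  assumes x: "x \<in> carrier A"
  shows "c \<odot>\<^bsub>Q\<^esub> proj x = proj (c \<odot> x)"
proof -
  have const: "proj (c \<odot> y) = proj (c \<odot> x)" if "y \<in> proj x" for y
  proof -
    have y: "y \<in> carrier A"
      using that x by (meson a_r_coset_subset_G a_subset subsetD)
    have "y \<ominus>\<^bsub>A\<^esub> x \<in> I"
      using that x y by (metis a_repr_independence a_subgroup proj_eq_iff)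
    then have "c \<odot> (y \<ominus>\<^bsub>A\<^esub> x) \<in> I" by (rule ideal_scale)
    moreover have "c \<odot> (y \<ominus>\<^bsub>A\<^esub> x) = c \<odot> y \<ominus>\<^bsub>A\<^esub> c \<odot> x"
      using x y by (simp add: diff_eq_scale scale_distrib_right scale_scale)
    ultimately show ?thesis using x y by (simp add: proj_eq_iff)
  qed
  have "c \<odot>\<^bsub>Q\<^esub> proj x = (\<Union>y\<in>proj x. proj (c \<odot> y))"
    by (simp add: quotient_algebra_def)
  also have "\<dots> = (\<Union>y\<in>proj x. proj (c \<odot> x))"
    by (rule SUP_cong) (rule refl, erule const)
  also have "\<dots> = proj (c \<odot> x)"
    using a_rcos_self[OF x] by blast
  finally show ?thesis .
qed

lemma ring_over_complex_quotient: "ring_over_complex Q"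
proof (intro ring_over_complex.intro ring_over_complex_axioms.intro)
  have zero: "\<zero>\<^bsub>Q\<^esub> = proj \<zero>"
    using a_coset_add_zero[OF a_subset] by (simp add: quotient_algebra_def FactRing_simps)
  show "ring Q"
  proof (rule ringI)
    show "abelian_group Q"
    proof (rule abelian_groupI)
      fix X assume "X \<in> carrier Q"
      then obtain x where x: "x \<in> carrier A" "X = proj x" by (auto simp: quotient_carrier)
      then have "proj (\<ominus> x) \<oplus>\<^bsub>Q\<^esub> X = \<zero>\<^bsub>Q\<^esub>"
        by (simp add: proj_ops zero l_neg)
      then show "\<exists>Y\<in>carrier Q. Y \<oplus>\<^bsub>Q\<^esub> X = \<zero>\<^bsub>Q\<^esub>" using x by blast
    qed (auto simp: quotient_carrier proj_ops zero a_ac)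
    show "Group.monoid Q"
      by (rule monoidI) (auto simp: quotient_carrier proj_ops proj_one m_assoc)
  qed (auto simp: quotient_carrier proj_ops l_distr r_distr)
qed (auto simp: quotient_carrier proj_ops proj_scale scale_distrib_left scale_distrib_right
  scale_scale scale_one scale_mult_left scale_mult_right)

lemma functional_descends:
  assumes f: "linear_functional A f" and "\<And>x. x \<in> I \<Longrightarrow> f x = 0"
  obtains F where "linear_functional Q F" "\<And>x. x \<in> carrier A \<Longrightarrow> F (proj x) = f x"
proof
  define F where "F X = f (SOME x. x \<in> carrier A \<and> X = proj x)" for X
  show F: "F (proj x) = f x" if x: "x \<in> carrier A" for x
  proof -
    define y where "y = (SOME y. y \<in> carrier A \<and> proj x = proj y)"
    have y: "y \<in> carrier A \<and> proj x = proj y"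
      unfolding y_def by (rule someI[of _ x]) (use x in auto)
    then have "x \<ominus>\<^bsub>A\<^esub> y \<in> I" using x by (metis proj_eq_iff)
    then have "f (x \<ominus>\<^bsub>A\<^esub> y) = 0" using assms by blast
    then have "f x = f y"
      using linear_functional_diff[OF f x] y by simp
    moreover have "F (proj x) = f y" unfolding F_def y_def ..
    ultimately show ?thesis by simp
  qed
  show "linear_functional Q F"
    using f by (auto simp: linear_functional_def quotient_carrier proj_ops proj_scale F)
qed

end

section \<open>Monoid algebras\<close>

definition linear_extension :: "('w \<Rightarrow> complex) \<Rightarrow> ('w \<Rightarrow> complex) \<Rightarrow> complex" where
  "linear_extension \<Phi> f = (\<Sum>w | f w \<noteq> 0. f w * \<Phi> w)"

definition finite_support :: "('w \<Rightarrow> complex) \<Rightarrow> bool" where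
  "finite_support f \<longleftrightarrow> finite {w. f w \<noteq> 0}"

lemma finite_support_simps:
  "finite_support f \<Longrightarrow> finite_support g \<Longrightarrow> finite_support (\<lambda>w. f w + g w)"
  "finite_support f \<Longrightarrow> finite_support (\<lambda>w. c * f w)"
  "finite_support (basis w)" "finite_support (\<lambda>w. 0)"
proof -
  assume fg: "finite_support f" "finite_support g"
  have "{w. f w + g w \<noteq> 0} \<subseteq> {w. f w \<noteq> 0} \<union> {w. g w \<noteq> 0}" by auto
  then show "finite_support (\<lambda>w. f w + g w)"
    using fg unfolding finite_support_def by (meson finite_UnI finite_subset)
next
  assume f: "finite_support f"
  have "{w. c * f w \<noteq> 0} \<subseteq> {w. f w \<noteq> 0}" by auto
  then show "finite_support (\<lambda>w. c * f w)"
    using f unfolding finite_support_def by (rule finite_subset)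
qed (simp_all add: finite_support_def basis_def)

lemma linear_extension_superset:
  assumes "finite S" "{w. f w \<noteq> 0} \<subseteq> S"
  shows "linear_extension \<Phi> f = (\<Sum>w\<in>S. f w * \<Phi> w)"
  unfolding linear_extension_def using assms by (intro sum.mono_neutral_left) auto

lemma linear_extension_add:
  assumes "finite_support f" "finite_support g"
  shows "linear_extension \<Phi> (\<lambda>w. f w + g w) = linear_extension \<Phi> f + linear_extension \<Phi> g"
proof -
  let ?S = "{w. f w \<noteq> 0} \<union> {w. g w \<noteq> 0}"
  have S: "finite ?S" using assms by (simp add: finite_support_def)
  have sub: "{w. f w + g w \<noteq> 0} \<subseteq> ?S" by auto
  show ?thesis
    by (simp add: linear_extension_superset[OF S sub] linear_extension_superset[OF S Un_upper1]
        linear_extension_superset[OF S Un_upper2] sum.distrib distrib_right)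
qed

lemma linear_extension_scale:
  "linear_extension \<Phi> (\<lambda>w. c * f w) = c * linear_extension \<Phi> f"
  by (cases "c = 0") (simp_all add: linear_extension_def sum_distrib_left mult.assoc)

lemma linear_extension_basis [simp]: "linear_extension \<Phi> (basis w) = \<Phi> w"
  using linear_extension_superset[of "{w}" "basis w" \<Phi>] by (simp add: basis_def)

lemma linear_extension_cong:
  "(\<And>w. f w \<noteq> 0 \<Longrightarrow> \<Phi> w = \<Psi> w) \<Longrightarrow> linear_extension \<Phi> f = linear_extension \<Psi> f"
  unfolding linear_extension_def by (auto intro: sum.cong)

lemma linear_extension_swap:
  "linear_extension (\<lambda>u. linear_extension (\<Phi> u) g) f
    = linear_extension (\<lambda>v. linear_extension (\<lambda>u. \<Phi> u v) f) g"
  unfolding linear_extension_def sum_distrib_left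
  by (subst sum.swap) (auto intro!: sum.cong simp: algebra_simps)

lemma linear_extension_add_fun:
  "linear_extension (\<lambda>w. \<Phi> w + \<Psi> w) f = linear_extension \<Phi> f + linear_extension \<Psi> f"
  by (simp add: linear_extension_def sum.distrib algebra_simps)

lemma linear_extension_scale_fun:
  "linear_extension (\<lambda>w. c * \<Phi> w) f = c * linear_extension \<Phi> f"
  by (simp add: linear_extension_def sum_distrib_left algebra_simps)

lemma linear_extension_coefficient:
  assumes "finite_support f"
  shows "linear_extension (basis w) f = f w"
proof -
  have "linear_extension (basis w) f = (\<Sum>v\<in>insert w {v. f v \<noteq> 0}. f v * basis w v)"
    using assms by (intro linear_extension_superset) (auto simp: finite_support_def)
  also have "\<dots> = (\<Sum>v\<in>insert w {v. f v \<noteq> 0}. if v = w then f v else 0)"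
    by (intro sum.cong) (auto simp: basis_def)
  also have "\<dots> = f w"
    using assms by (subst sum.delta) (auto simp: finite_support_def)
  finally show ?thesis .
qed

text \<open>
  Every coefficient is the value of a linear extension, so identities in a monoid algebra can be
  tested on all linear extensions. Together with
  \<open>linear_extension_mult\<close> below, this turns associativity of the convolution into associativity of
  the monoid inside an iterated sum.
\<close>

lemma linear_extension_ext:
  assumes "finite_support f" "finite_support g"
    and "\<And>\<Phi>. linear_extension \<Phi> f = linear_extension \<Phi> g"
  shows "f = g"
  using assms by (metis ext linear_extension_coefficient)

locale monoid_with_algebra = monoid G for G (structure)
begin

abbreviation F where "F \<equiv> monoid_algebra G"

lemma monoid_algebra_simps:
  "x \<oplus>\<^bsub>F\<^esub> y = (\<lambda>w. x w + y w)" "\<zero>\<^bsub>F\<^esub> = (\<lambda>w. 0)" "\<one>\<^bsub>F\<^esub> = basis \<one>"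
  "c \<odot>\<^bsub>F\<^esub> x = (\<lambda>w. c * x w)"
  by (auto simp: monoid_algebra_def basis_def)

lemma carrier_monoid_algebra:
  "f \<in> carrier F \<longleftrightarrow> finite_support f \<and> (\<forall>w. f w \<noteq> 0 \<longrightarrow> w \<in> carrier G)"
  by (auto simp: monoid_algebra_def finite_support_def)

lemma basis_in_carrier [simp]: "basis w \<in> carrier F \<longleftrightarrow> w \<in> carrier G"
  by (auto simp: carrier_monoid_algebra finite_support_def basis_def)

lemma monoid_algebra_mult_support:
  assumes "(f \<otimes>\<^bsub>F\<^esub> g) w \<noteq> 0"
  shows "\<exists>u v. f u \<noteq> 0 \<and> g v \<noteq> 0 \<and> u \<otimes> v = w"
proof (rule ccontr)
  assume "\<not> ?thesis"
  then have empty: "{(u, v). f u \<noteq> 0 \<and> g v \<noteq> 0 \<and> u \<otimes> v = w} = {}" by auto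
  have "(f \<otimes>\<^bsub>F\<^esub> g) w = (\<Sum>(u, v) | f u \<noteq> 0 \<and> g v \<noteq> 0 \<and> u \<otimes> v = w. f u * g v)"
    by (simp add: monoid_algebra_def)
  then show False using assms unfolding empty by simp
qed

lemma finite_support_mult:
  assumes "finite_support f" "finite_support g"
  shows "finite_support (f \<otimes>\<^bsub>F\<^esub> g)"
proof -
  have "{w. (f \<otimes>\<^bsub>F\<^esub> g) w \<noteq> 0} \<subseteq> (\<lambda>(u, v). u \<otimes> v) ` ({u. f u \<noteq> 0} \<times> {v. g v \<noteq> 0})"
    using monoid_algebra_mult_support by force
  then show ?thesis
    using assms by (auto simp: finite_support_def intro: finite_subset)
qed

text \<open>
  The convolution is the bilinear extension of the product of the monoid: regroup the double sum over
  the two supports by the value of the product.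
\<close>

lemma linear_extension_mult:
  assumes "finite_support f" "finite_support g"
  shows "linear_extension \<Phi> (f \<otimes>\<^bsub>F\<^esub> g)
    = linear_extension (\<lambda>u. linear_extension (\<lambda>v. \<Phi> (u \<otimes> v)) g) f"
proof -
  let ?P = "{u. f u \<noteq> 0} \<times> {v. g v \<noteq> 0}"
  let ?h = "\<lambda>(u, v). u \<otimes> v"
  have fin: "finite ?P" using assms by (simp add: finite_support_def)
  have "linear_extension \<Phi> (f \<otimes>\<^bsub>F\<^esub> g) = (\<Sum>w\<in>?h ` ?P. (f \<otimes>\<^bsub>F\<^esub> g) w * \<Phi> w)"
    using fin monoid_algebra_mult_support by (intro linear_extension_superset) force+
  also have "\<dots> = (\<Sum>w\<in>?h ` ?P. \<Sum>p\<in>{p \<in> ?P. ?h p = w}. f (fst p) * g (snd p) * \<Phi> (?h p))"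
  proof (rule sum.cong)
    fix w
    have eq: "{(u, v). f u \<noteq> 0 \<and> g v \<noteq> 0 \<and> u \<otimes> v = w} = {p \<in> ?P. ?h p = w}" by auto
    have "(f \<otimes>\<^bsub>F\<^esub> g) w = (\<Sum>(u, v) | f u \<noteq> 0 \<and> g v \<noteq> 0 \<and> u \<otimes> v = w. f u * g v)"
      by (simp add: monoid_algebra_def)
    also have "\<dots> = (\<Sum>p\<in>{p \<in> ?P. ?h p = w}. f (fst p) * g (snd p))"
      unfolding eq by (simp add: case_prod_unfold)
    finally have "(f \<otimes>\<^bsub>F\<^esub> g) w = (\<Sum>p\<in>{p \<in> ?P. ?h p = w}. f (fst p) * g (snd p))" .
    then show "(f \<otimes>\<^bsub>F\<^esub> g) w * \<Phi> w
        = (\<Sum>p\<in>{p \<in> ?P. ?h p = w}. f (fst p) * g (snd p) * \<Phi> (?h p))"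
      by (simp add: sum_distrib_right)
  qed simp
  also have "\<dots> = (\<Sum>p\<in>?P. f (fst p) * g (snd p) * \<Phi> (?h p))"
    using fin by (intro sum.group) auto
  also have "\<dots> = (\<Sum>u | f u \<noteq> 0. \<Sum>v | g v \<noteq> 0. f u * g v * \<Phi> (u \<otimes> v))"
    by (simp add: sum.cartesian_product case_prod_unfold)
  finally show ?thesis
    by (simp add: linear_extension_def sum_distrib_left mult.assoc)
qed

lemma monoid_algebra_mult_closed:
  assumes "f \<in> carrier F" "g \<in> carrier F"
  shows "f \<otimes>\<^bsub>F\<^esub> g \<in> carrier F"
  using assms finite_support_mult[of f g] monoid_algebra_mult_support[of f g]
  by (force simp: carrier_monoid_algebra)

lemma ring_over_complex_monoid_algebra: "ring_over_complex F"
proof (intro ring_over_complex.intro ring_over_complex_axioms.intro)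
  show "ring F"
  proof (rule ringI)
    show "abelian_group F"
    proof (rule abelian_groupI)
      fix f assume f: "f \<in> carrier F"
      then have "(\<lambda>w. - f w) \<in> carrier F" 
        by (auto simp: carrier_monoid_algebra finite_support_def)
      moreover have "(\<lambda>w. - f w) \<oplus>\<^bsub>F\<^esub> f = \<zero>\<^bsub>F\<^esub>"
        by (simp add: monoid_algebra_simps)
      ultimately show "\<exists>g\<in>carrier F. g \<oplus>\<^bsub>F\<^esub> f = \<zero>\<^bsub>F\<^esub>" by blast
    qed (auto simp: monoid_algebra_simps algebra_simps carrier_monoid_algebra finite_support_simps, metis add.right_neutral)
    show "Group.monoid F"
    proof (rule monoidI)
      fix f g h assume fgh: "f \<in> carrier F" "g \<in> carrier F" "h \<in> carrier F"
      then have fin: "finite_support f" "finite_support g" "finite_support h"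
        and G: "\<And>w. f w \<noteq> 0 \<Longrightarrow> w \<in> carrier G" "\<And>w. g w \<noteq> 0 \<Longrightarrow> w \<in> carrier G"
          "\<And>w. h w \<noteq> 0 \<Longrightarrow> w \<in> carrier G"
        by (auto simp: carrier_monoid_algebra)
      show "f \<otimes>\<^bsub>F\<^esub> g \<otimes>\<^bsub>F\<^esub> h = f \<otimes>\<^bsub>F\<^esub> (g \<otimes>\<^bsub>F\<^esub> h)"
      proof (rule linear_extension_ext)
        fix \<Phi>
        show "linear_extension \<Phi> (f \<otimes>\<^bsub>F\<^esub> g \<otimes>\<^bsub>F\<^esub> h) = linear_extension \<Phi> (f \<otimes>\<^bsub>F\<^esub> (g \<otimes>\<^bsub>F\<^esub> h))"
          using fin by (simp add: linear_extension_mult finite_support_mult)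
            (intro linear_extension_cong, simp add: m_assoc G)
      qed (simp_all add: fin finite_support_mult)
      show "\<one>\<^bsub>F\<^esub> \<otimes>\<^bsub>F\<^esub> f = f"
        using fin G by (intro linear_extension_ext)
          (auto simp: linear_extension_mult finite_support_mult finite_support_simps
            monoid_algebra_simps intro!: linear_extension_cong)
      show "f \<otimes>\<^bsub>F\<^esub> \<one>\<^bsub>F\<^esub> = f"
        using fin G by (intro linear_extension_ext)
          (auto simp: linear_extension_mult finite_support_mult finite_support_simps
            monoid_algebra_simps intro!: linear_extension_cong)
    qed (auto simp: monoid_algebra_mult_closed, simp add: monoid_algebra_simps)
    fix f g h assume fgh: "f \<in> carrier F" "g \<in> carrier F" "h \<in> carrier F"
    then have fin: "finite_support f" "finite_support g" "finite_support h"
      by (auto simp: carrier_monoid_algebra)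
    show "(f \<oplus>\<^bsub>F\<^esub> g) \<otimes>\<^bsub>F\<^esub> h = f \<otimes>\<^bsub>F\<^esub> h \<oplus>\<^bsub>F\<^esub> g \<otimes>\<^bsub>F\<^esub> h"
      using fin by (intro linear_extension_ext)
        (auto simp: linear_extension_mult finite_support_mult finite_support_simps
          monoid_algebra_simps linear_extension_add)
    show "h \<otimes>\<^bsub>F\<^esub> (f \<oplus>\<^bsub>F\<^esub> g) = h \<otimes>\<^bsub>F\<^esub> f \<oplus>\<^bsub>F\<^esub> h \<otimes>\<^bsub>F\<^esub> g"
      using fin by (intro linear_extension_ext)
        (auto simp: linear_extension_mult finite_support_mult finite_support_simps
          monoid_algebra_simps linear_extension_add linear_extension_add_fun)
  qed
  fix f g c assume "f \<in> carrier F" "g \<in> carrier F"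
  then have fin: "finite_support f" "finite_support g"
    by (auto simp: carrier_monoid_algebra)
  show "(c \<odot>\<^bsub>F\<^esub> f) \<otimes>\<^bsub>F\<^esub> g = c \<odot>\<^bsub>F\<^esub> (f \<otimes>\<^bsub>F\<^esub> g)"
    using fin by (intro linear_extension_ext)
      (auto simp: linear_extension_mult finite_support_mult finite_support_simps
        monoid_algebra_simps linear_extension_scale)
  show "f \<otimes>\<^bsub>F\<^esub> (c \<odot>\<^bsub>F\<^esub> g) = c \<odot>\<^bsub>F\<^esub> (f \<otimes>\<^bsub>F\<^esub> g)"
    using fin by (intro linear_extension_ext)
      (auto simp: linear_extension_mult finite_support_mult finite_support_simps
        monoid_algebra_simps linear_extension_scale linear_extension_scale_fun)
qed (auto simp: monoid_algebra_simps algebra_simps carrier_monoid_algebra finite_support_simps)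

lemma basis_mult:
  "basis u \<otimes>\<^bsub>F\<^esub> basis v = basis (u \<otimes> v)"
  by (intro linear_extension_ext)
    (simp_all add: linear_extension_mult finite_support_mult finite_support_simps)

lemma linear_functional_linear_extension: "linear_functional F (linear_extension \<Phi>)"
  by (auto simp: linear_functional_def monoid_algebra_simps linear_extension_add
      linear_extension_scale carrier_monoid_algebra)

lemma monoid_algebra_induct [consumes 1, case_names zero basis add scale]:
  assumes f: "f \<in> carrier F"
    and zero: "P \<zero>\<^bsub>F\<^esub>"
    and basis: "\<And>w. w \<in> carrier G \<Longrightarrow> P (basis w)"
    and add: "\<And>f g. f \<in> carrier F \<Longrightarrow> g \<in> carrier F \<Longrightarrow> P f \<Longrightarrow> P g \<Longrightarrow> P (f \<oplus>\<^bsub>F\<^esub> g)"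
    and scale: "\<And>c f. f \<in> carrier F \<Longrightarrow> P f \<Longrightarrow> P (c \<odot>\<^bsub>F\<^esub> f)"
  shows "P f"
proof -
  interpret F: ring_over_complex F by (rule ring_over_complex_monoid_algebra)
  have "\<forall>f. f \<in> carrier F \<longrightarrow> {w. f w \<noteq> 0} \<subseteq> S \<longrightarrow> P f" if "finite S" for S
    using that
  proof (induction S)
    case empty
    have "f = \<zero>\<^bsub>F\<^esub>" if "{w. f w \<noteq> 0} \<subseteq> {}" for f
      using that by (auto simp: monoid_algebra_simps)
    then show ?case using zero by blast
  next
    case (insert w S)
    show ?case
    proof (intro allI impI)
      fix f assume f: "f \<in> carrier F" and supp: "{w. f w \<noteq> 0} \<subseteq> insert w S"
      show "P f"
      proof (cases "f w = 0")
        case True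
        then show ?thesis using insert.IH f supp by blast
      next
        case False
        let ?g = "f(w := 0)" and ?h = "f w \<odot>\<^bsub>F\<^esub> basis w"
        have w: "w \<in> carrier G" using False f by (simp add: carrier_monoid_algebra)
        have g: "?g \<in> carrier F"
          using f by (auto simp: carrier_monoid_algebra finite_support_def intro: rev_finite_subset)
        moreover have "{v. ?g v \<noteq> 0} \<subseteq> S" using supp by auto
        ultimately have "P ?g" using insert.IH by blast
        moreover have "P ?h" using w by (intro scale basis) auto
        ultimately have "P (?g \<oplus>\<^bsub>F\<^esub> ?h)" using g w by (intro add) auto
        moreover have "?g \<oplus>\<^bsub>F\<^esub> ?h = f"
          by (auto simp: monoid_algebra_simps basis_def)
        ultimately show ?thesis by simp
      qed
    qed
  qed
  then show ?thesis using f by (auto simp: carrier_monoid_algebra finite_support_def)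
qed

end

section \<open>Algebras given by generators and relations\<close>

text \<open>
  The extension by an idempotent and the tensor product are both quotients of a monoid algebra by
  the ideal generated by a set of relations. What is needed about them (spanning by classes of
  monoid elements, and existence of functionals) holds for all such quotients.
\<close>

locale presented_algebra = monoid_with_algebra G for G (structure) +
  fixes R :: "(('a \<Rightarrow> complex) \<times> ('a \<Rightarrow> complex)) set"
  assumes relations_closed: "R \<subseteq> carrier F \<times> carrier F"
begin

abbreviation T where "T \<equiv> quotient_algebra F (relation_ideal F R)"
abbreviation gen where "gen w \<equiv> relation_ideal F R +>\<^bsub>F\<^esub> basis w"

lemma relation_differences_closed: "{u \<ominus>\<^bsub>F\<^esub> v | u v. (u, v) \<in> R} \<subseteq> carrier F"
proof -
  interpret F: ring_over_complex F by (rule ring_over_complex_monoid_algebra)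
  show ?thesis using relations_closed by auto
qed

sublocale quotient: algebra_quotient F "relation_ideal F R"
proof -
  interpret F: ring_over_complex F by (rule ring_over_complex_monoid_algebra)
  show "algebra_quotient F (relation_ideal F R)"
    unfolding relation_ideal_def
    by (intro algebra_quotient.intro F.genideal_ideal ring_over_complex_monoid_algebra
        relation_differences_closed)
qed

lemma ring_over_complex_T: "ring_over_complex T"
  by (rule quotient.ring_over_complex_quotient)

lemma gen_closed [simp, intro]: "w \<in> carrier G \<Longrightarrow> gen w \<in> carrier T"
  by simp

lemma gen_mult:
  "u \<in> carrier G \<Longrightarrow> v \<in> carrier G \<Longrightarrow> gen u \<otimes>\<^bsub>T\<^esub> gen v = gen (u \<otimes> v)"
  by (simp add: quotient.proj_ops basis_mult)

lemma gen_one: "gen \<one> = \<one>\<^bsub>T\<^esub>"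
  by (simp add: quotient.proj_one monoid_algebra_simps)

lemma relation_holds:
  assumes "(r, s) \<in> R"
  shows "relation_ideal F R +>\<^bsub>F\<^esub> r = relation_ideal F R +>\<^bsub>F\<^esub> s"
proof -
  have "r \<ominus>\<^bsub>F\<^esub> s \<in> {u \<ominus>\<^bsub>F\<^esub> v | u v. (u, v) \<in> R}" using assms by blast
  then have "r \<ominus>\<^bsub>F\<^esub> s \<in> relation_ideal F R"
    unfolding relation_ideal_def using quotient.genideal_self[OF relation_differences_closed] by blast
  then show ?thesis
    using assms relations_closed by (subst quotient.proj_eq_iff) auto
qed

lemma quotient_induct [consumes 1, case_names gen add scale]:
  assumes X: "X \<in> carrier T"
    and cls: "\<And>w. w \<in> carrier G \<Longrightarrow> P (gen w)"
    and add: "\<And>X Y. X \<in> carrier T \<Longrightarrow> Y \<in> carrier T \<Longrightarrow> P X \<Longrightarrow> P Y \<Longrightarrow> P (X \<oplus>\<^bsub>T\<^esub> Y)"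
    and scale: "\<And>c X. X \<in> carrier T \<Longrightarrow> P X \<Longrightarrow> P (c \<odot>\<^bsub>T\<^esub> X)"
  shows "P X"
proof -
  have "P (relation_ideal F R +>\<^bsub>F\<^esub> f)" if "f \<in> carrier F" for f
    using that
  proof (induction rule: monoid_algebra_induct)
    case zero
    have "\<zero>\<^bsub>F\<^esub> = 0 \<odot>\<^bsub>F\<^esub> basis \<one>" by (simp add: monoid_algebra_simps)
    moreover have "P (0 \<odot>\<^bsub>T\<^esub> gen \<one>)" by (intro scale cls) auto
    ultimately show ?case by (simp add: quotient.proj_scale)
  next
    case (add f g)
    then have "P ((relation_ideal F R +>\<^bsub>F\<^esub> f) \<oplus>\<^bsub>T\<^esub> (relation_ideal F R +>\<^bsub>F\<^esub> g))"
      by (intro assms(3)) auto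
    then show ?case using add by (simp add: quotient.proj_ops)
  next
    case (scale c f)
    then have "P (c \<odot>\<^bsub>T\<^esub> (relation_ideal F R +>\<^bsub>F\<^esub> f))"
      by (intro assms(4)) auto
    then show ?case using scale by (simp add: quotient.proj_scale)
  qed (rule cls)
  then show ?thesis using X by (auto simp: quotient.quotient_carrier)
qed

text \<open>
  Classes of monoid elements span, so functionals of one or two arguments are compared on them.
\<close>

lemma functional_eqI:
  assumes "linear_functional T H" "linear_functional T K"
    and "\<And>w. w \<in> carrier G \<Longrightarrow> H (gen w) = K (gen w)" and "X \<in> carrier T"
  shows "H X = K X"
  using assms(4)
  by (induction rule: quotient_induct)
    (simp_all add: assms(3) linear_functionalD[OF assms(1)] linear_functionalD[OF assms(2)])

lemma bilinear_eqI:
  assumes "\<And>y. y \<in> carrier T \<Longrightarrow> linear_functional T (\<lambda>x. L x y)"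
    and "\<And>x. x \<in> carrier T \<Longrightarrow> linear_functional T (L x)"
    and "\<And>y. y \<in> carrier T \<Longrightarrow> linear_functional T (\<lambda>x. M x y)"
    and "\<And>x. x \<in> carrier T \<Longrightarrow> linear_functional T (M x)"
    and "\<And>u v. u \<in> carrier G \<Longrightarrow> v \<in> carrier G \<Longrightarrow> L (gen u) (gen v) = M (gen u) (gen v)"
    and "x \<in> carrier T" "y \<in> carrier T"
  shows "L x y = M x y"
proof -
  have "L x (gen v) = M x (gen v)" if v: "v \<in> carrier G" for v
    using assms v by (intro functional_eqI[of "\<lambda>x. L x (gen v)" "\<lambda>x. M x (gen v)" x]) auto
  then show ?thesis
    using assms by (intro functional_eqI[of "L x" "M x" y]) auto
qed

text \<open>
  A function on the monoid defines a functional on the quotient as soon as its linear extension does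
  not distinguish the two sides of a relation placed between any two monoid elements: the elements
  annihilated in all such contexts form a two-sided ideal, which contains the relations and therefore
  the ideal that they generate.
\<close>

lemma functional_exists:
  assumes compatible: "\<And>r s u v. (r, s) \<in> R \<Longrightarrow> u \<in> carrier G \<Longrightarrow> v \<in> carrier G \<Longrightarrow>
      linear_extension (\<lambda>w. \<Phi> (u \<otimes> w \<otimes> v)) r = linear_extension (\<lambda>w. \<Phi> (u \<otimes> w \<otimes> v)) s"
  obtains H where "linear_functional T H" "\<And>w. w \<in> carrier G \<Longrightarrow> H (gen w) = \<Phi> w"
proof -
  define \<Lambda> where "\<Lambda> u v = linear_extension (\<lambda>w. \<Phi> (u \<otimes> w \<otimes> v))" for u v
  define N where "N = {f \<in> carrier F. \<forall>u\<in>carrier G. \<forall>v\<in>carrier G. \<Lambda> u v f = 0}"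
  have lin: "linear_functional F (\<Lambda> u v)" for u v
    unfolding \<Lambda>_def by (rule linear_functional_linear_extension)
  have supp: "finite_support f" "\<And>w. f w \<noteq> 0 \<Longrightarrow> w \<in> carrier G" if "f \<in> carrier F" for f
    using that by (auto simp: carrier_monoid_algebra)
  have ideal: "ideal N F"
  proof (rule idealI)
    show "ring F" by (rule quotient.ring_axioms)
    show "subgroup N (add_monoid F)"
    proof
      fix f assume "f \<in> N"
      then have "\<ominus>\<^bsub>F\<^esub> f \<in> N"
        using linear_functionalD(2)[OF lin] by (simp add: N_def quotient.minus_eq_scale)
      then show "inv\<^bsub>add_monoid F\<^esub> f \<in> N" by (simp add: a_inv_def)
    qed (auto simp: N_def linear_functionalD(1)[OF lin] quotient.linear_functional_zero[OF lin])
    fix f g assume f: "f \<in> N" and g: "g \<in> carrier F"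
    then have f': "f \<in> carrier F" by (simp add: N_def)
    have "\<Lambda> u v (g \<otimes>\<^bsub>F\<^esub> f) = 0" if u: "u \<in> carrier G" and v: "v \<in> carrier G" for u v
    proof -
      have "\<Lambda> u v (g \<otimes>\<^bsub>F\<^esub> f) = linear_extension (\<lambda>a. \<Lambda> (u \<otimes> a) v f) g"
        unfolding \<Lambda>_def linear_extension_mult[OF supp(1)[OF g] supp(1)[OF f']]
        using u v supp(2)[OF g] supp(2)[OF f'] 
        by (intro linear_extension_cong) (simp add: m_assoc)
      also have "\<dots> = linear_extension (\<lambda>a. 0) g"
        using f u v supp(2)[OF g] by (intro linear_extension_cong) (simp add: N_def)
      finally show ?thesis by (simp add: linear_extension_def)
    qed
    then show "g \<otimes>\<^bsub>F\<^esub> f \<in> N" using f' g by (simp add: N_def)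
    have "\<Lambda> u v (f \<otimes>\<^bsub>F\<^esub> g) = 0" if u: "u \<in> carrier G" and v: "v \<in> carrier G" for u v
    proof -
      have "\<Lambda> u v (f \<otimes>\<^bsub>F\<^esub> g)
          = linear_extension (\<lambda>b. linear_extension (\<lambda>a. \<Phi> (u \<otimes> (a \<otimes> b) \<otimes> v)) f) g"
        unfolding \<Lambda>_def linear_extension_mult[OF supp(1)[OF f'] supp(1)[OF g]]
        by (rule linear_extension_swap)
      also have "\<dots> = linear_extension (\<lambda>b. \<Lambda> u (b \<otimes> v) f) g"
        unfolding \<Lambda>_def using u v supp(2)[OF g] supp(2)[OF f'] 
        by (intro linear_extension_cong) (simp add: m_assoc)
      also have "\<dots> = linear_extension (\<lambda>a. 0) g"
        using f u v supp(2)[OF g] by (intro linear_extension_cong) (simp add: N_def)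
      finally show ?thesis by (simp add: linear_extension_def)
    qed
    then show "f \<otimes>\<^bsub>F\<^esub> g \<in> N" using f' g by (simp add: N_def)
  qed
  have "{r \<ominus>\<^bsub>F\<^esub> s | r s. (r, s) \<in> R} \<subseteq> N"
  proof clarify
    fix r s assume rs: "(r, s) \<in> R"
    then have "r \<in> carrier F" "s \<in> carrier F" using relations_closed by auto
    then show "r \<ominus>\<^bsub>F\<^esub> s \<in> N"
      using compatible[OF rs] quotient.linear_functional_diff[OF lin]
      by (simp add: N_def) (simp add: \<Lambda>_def)
  qed
  then have "relation_ideal F R \<subseteq> N"
    unfolding relation_ideal_def by (rule quotient.genideal_minimal[OF ideal])
  then have vanish: "\<Lambda> \<one> \<one> f = 0" if "f \<in> relation_ideal F R" for f
    using that by (auto simp: N_def)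
  obtain H where lin_H: "linear_functional T H"
    and H: "\<And>f. f \<in> carrier F \<Longrightarrow> H (relation_ideal F R +>\<^bsub>F\<^esub> f) = \<Lambda> \<one> \<one> f"
    using quotient.functional_descends[OF lin vanish] by blast
  have "H (gen w) = \<Phi> w" if "w \<in> carrier G" for w
  proof -
    have "H (gen w) = \<Lambda> \<one> \<one> (basis w)" using that by (intro H) simp
    then show ?thesis using that by (simp add: \<Lambda>_def)
  qed
  then show ?thesis by (rule that[OF lin_H])
qed

end

section \<open>The extension by an idempotent\<close>

lemma interleave_Cons: "interleave p (x # xs) = x # concat (map (\<lambda>y. [p, y]) xs)"
  by (induction xs arbitrary: x) auto

lemma interleave_append:
  "xs \<noteq> [] \<Longrightarrow> ys \<noteq> [] \<Longrightarrow> interleave p (xs @ ys) = interleave p xs @ p # interleave p ys"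
  by (cases xs; cases ys) (auto simp: interleave_Cons)

lemma map_interleave: "map f (interleave p xs) = interleave (f p) (map f xs)"
  by (induction p xs rule: interleave.induct) auto

text \<open>
  The word \<open>P\<^sup>\<alpha> b\<^sub>1 P b\<^sub>2 P \<dots> P b\<^sub>n P\<^sup>\<beta>\<close>. Working with words and their classes instead of
  products in the extension makes concatenation available.
\<close>

definition alternating_word :: "nat \<Rightarrow> 'a list \<Rightarrow> nat \<Rightarrow> 'a letter list" where
  "alternating_word \<alpha> bs \<beta> =
     replicate \<alpha> Proj @ interleave Proj (map Elem bs) @ replicate \<beta> Proj"

locale idempotent_extension = ring_over_complex B
  for B :: "(complex, 'a, 'm) module_scheme" (structure)
begin

lemma word_monoid_simps [simp]:
  "carrier (word_monoid B) = {w. set w \<subseteq> insert Proj (Elem ` carrier B)}"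
  "u \<otimes>\<^bsub>word_monoid B\<^esub> v = u @ v" "\<one>\<^bsub>word_monoid B\<^esub> = []"
  by (auto simp: word_monoid_def lists_eq_set)

sublocale words: monoid_with_algebra "word_monoid B"
  by (intro monoid_with_algebra.intro monoidI) auto

sublocale words: presented_algebra "word_monoid B" "extension_relations B"
proof
  interpret F: ring_over_complex words.F by (rule words.ring_over_complex_monoid_algebra)
  show "extension_relations B \<subseteq> carrier words.F \<times> carrier words.F"
    by (auto simp: extension_relations_def Let_def)
qed

lemma extension_eq: "extension B = words.T"
  by (simp add: extension_def extension_ideal_def)

lemma ext_emb_eq: "ext_emb B b = words.gen [Elem b]"
  by (simp add: ext_emb_def extension_ideal_def)

lemma ext_P_eq: "ext_P B = words.gen [Proj]"
  by (simp add: ext_P_def extension_ideal_def)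

sublocale ext: ring_over_complex "extension B"
  unfolding extension_eq by (rule words.ring_over_complex_T)

lemma ext_P_closed [simp, intro]: "ext_P B \<in> carrier (extension B)"
  by (simp add: extension_eq ext_P_eq)

lemma ext_emb_closed [simp, intro]: "b \<in> carrier B \<Longrightarrow> ext_emb B b \<in> carrier (extension B)"
  by (simp add: extension_eq ext_emb_eq)

lemma gen_append:
  "u \<in> carrier (word_monoid B) \<Longrightarrow> v \<in> carrier (word_monoid B) \<Longrightarrow>
    words.gen (u @ v) = words.gen u \<otimes>\<^bsub>extension B\<^esub> words.gen v"
  using words.gen_mult[of u v] by (simp add: extension_eq)

lemma ext_P_idem: "ext_P B \<otimes>\<^bsub>extension B\<^esub> ext_P B = ext_P B"
proof -
  have "(basis [Proj, Proj], basis [Proj]) \<in> extension_relations B"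
    by (simp add: extension_relations_def Let_def)
  from words.relation_holds[OF this] show ?thesis
    using gen_append[of "[Proj]" "[Proj]"] by (simp add: ext_P_eq)
qed

lemma ext_emb_one: "ext_emb B \<one> = \<one>\<^bsub>extension B\<^esub>"
proof -
  have "(basis [Elem \<one>], basis []) \<in> extension_relations B"
    by (simp add: extension_relations_def Let_def)
  from words.relation_holds[OF this] show ?thesis
    using words.gen_one by (simp add: ext_emb_eq extension_eq)
qed

lemma ext_emb_mult:
  assumes "x \<in> carrier B" "y \<in> carrier B"
  shows "ext_emb B (x \<otimes> y) = ext_emb B x \<otimes>\<^bsub>extension B\<^esub> ext_emb B y"
proof -
  have "(basis [Elem (x \<otimes> y)], basis [Elem x, Elem y]) \<in> extension_relations B"
    using assms unfolding extension_relations_def Let_def by blast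
  from words.relation_holds[OF this] show ?thesis
    using assms gen_append[of "[Elem x]" "[Elem y]"] by (simp add: ext_emb_eq)
qed

lemma ext_emb_add:
  assumes "x \<in> carrier B" "y \<in> carrier B"
  shows "ext_emb B (x \<oplus> y) = ext_emb B x \<oplus>\<^bsub>extension B\<^esub> ext_emb B y"
proof -
  have "(basis [Elem (x \<oplus> y)], basis [Elem x] \<oplus>\<^bsub>words.F\<^esub> basis [Elem y]) \<in> extension_relations B"
    using assms unfolding extension_relations_def Let_def by blast
  from words.relation_holds[OF this] show ?thesis
    using assms by (simp add: ext_emb_eq extension_eq words.quotient.proj_ops)
qed

lemma ext_emb_scale:
  assumes "x \<in> carrier B"
  shows "ext_emb B (c \<odot> x) = c \<odot>\<^bsub>extension B\<^esub> ext_emb B x"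
proof -
  have "(basis [Elem (c \<odot> x)], c \<odot>\<^bsub>words.F\<^esub> basis [Elem x]) \<in> extension_relations B"
    using assms unfolding extension_relations_def Let_def by blast
  from words.relation_holds[OF this] show ?thesis
    using assms by (simp add: ext_emb_eq extension_eq words.quotient.proj_scale)
qed

lemma alternating_word_closed:
  "set bs \<subseteq> carrier B \<Longrightarrow> alternating_word \<alpha> bs \<beta> \<in> carrier (word_monoid B)"
  by (cases bs) (auto simp: alternating_word_def interleave_Cons)

lemma list_product_gen:
  "w \<in> carrier (word_monoid B) \<Longrightarrow>
    list_product (extension B) (map (\<lambda>l. words.gen [l]) w) = words.gen w"
proof (induction w)
  case Nil
  then show ?case using words.gen_one by (simp add: extension_eq)
next
  case (Cons l w)
  then show ?case using gen_append[of "[l]" w] by simp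
qed

lemma list_product_alternating:
  assumes "set bs \<subseteq> carrier B"
  shows "list_product (extension B)
      (replicate \<alpha> (ext_P B) @ interleave (ext_P B) (map (ext_emb B) bs) @ replicate \<beta> (ext_P B))
    = words.gen (alternating_word \<alpha> bs \<beta>)"
  using list_product_gen[OF alternating_word_closed[OF assms, of \<alpha> \<beta>]]
  by (simp add: alternating_word_def map_interleave ext_P_eq ext_emb_eq[abs_def] comp_def)

lemma gen_eq_context:
  assumes "u \<in> carrier (word_monoid B)" "v \<in> carrier (word_monoid B)"
    and "x \<in> carrier (word_monoid B)" "y \<in> carrier (word_monoid B)"
    and "words.gen x = words.gen y"
  shows "words.gen (u @ x @ v) = words.gen (u @ y @ v)"
  using assms gen_append[of u "x @ v"] gen_append[of u "y @ v"] gen_append[of x v] gen_append[of y v]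
  by simp

text \<open>
  Normal form: a letter of \<open>B\<close> in front of an alternating word either merges with its first letter
  or is separated from it by \<open>P\<close>, and a letter \<open>P\<close> is absorbed by a leading \<open>P\<close>. The empty word is
  the alternating word of the unit, and \<open>P = P 1\<close>.
\<close>

lemma gen_alternating:
  assumes "w \<in> carrier (word_monoid B)"
  shows "\<exists>\<alpha>\<in>{0, 1}. \<exists>\<beta>\<in>{0, 1}. \<exists>bs. bs \<noteq> [] \<and> set bs \<subseteq> carrier B \<and>
    words.gen w = words.gen (alternating_word \<alpha> bs \<beta>)"
  using assms
proof (induction w)
  case Nil
  have "words.gen [] = words.gen (alternating_word 0 [\<one>] 0)"
    using words.gen_one ext_emb_one by (simp add: alternating_word_def ext_emb_eq extension_eq)
  then show ?case by (intro bexI[of _ 0] exI[of _ "[\<one>]"]) auto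
next
  case (Cons l w)
  then obtain \<alpha> \<beta> bs where \<alpha>: "\<alpha> \<in> {0, 1::nat}" and \<beta>: "\<beta> \<in> {0, 1::nat}" and "bs \<noteq> []"
    and bs: "set bs \<subseteq> carrier B" and w: "words.gen w = words.gen (alternating_word \<alpha> bs \<beta>)"
    by auto
  then obtain c cs where bs_eq: "bs = c # cs" by (cases bs) auto
  define r where "r = concat (map (\<lambda>y. [Proj, y]) (map Elem cs)) @ replicate \<beta> Proj"
  have r: "r \<in> carrier (word_monoid B)" using bs by (auto simp: r_def bs_eq)
  have alt: "alternating_word \<gamma> (x # cs) \<beta> = replicate \<gamma> Proj @ Elem x # r" for \<gamma> x
    by (simp add: alternating_word_def interleave_Cons r_def)
  have lw: "words.gen (l # w) = words.gen (l # alternating_word \<alpha> bs \<beta>)"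
    using gen_eq_context[of "[l]" "[]" w "alternating_word \<alpha> bs \<beta>"] Cons.prems w bs
      alternating_word_closed[OF bs] by simp
  show ?case
  proof (cases l)
    case Proj
    have "words.gen (l # alternating_word \<alpha> bs \<beta>) = words.gen (alternating_word 1 bs \<beta>)"
    proof (cases "\<alpha> = 0")
      case True
      then show ?thesis by (simp add: Proj alternating_word_def)
    next
      case False
      then show ?thesis
        using \<alpha> bs r ext_P_idem gen_append[of "[Proj]" "[Proj]"]
          gen_eq_context[of "[]" "Elem c # r" "[Proj, Proj]" "[Proj]"]
        by (simp add: Proj alt bs_eq ext_P_eq)
    qed
    then show ?thesis using lw \<beta> bs by (intro bexI[of _ 1] bexI[of _ \<beta>] exI[of _ bs]) (auto simp: bs_eq)
  next
    case (Elem b)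
    then have b: "b \<in> carrier B" using Cons.prems by auto
    show ?thesis
    proof (cases "\<alpha> = 0")
      case True
      have "words.gen [Elem b, Elem c] = words.gen [Elem (b \<otimes> c)]"
        using b bs ext_emb_mult[of b c] gen_append[of "[Elem b]" "[Elem c]"]
        by (simp add: ext_emb_eq bs_eq)
      then have "words.gen (l # alternating_word \<alpha> bs \<beta>)
          = words.gen (alternating_word 0 ((b \<otimes> c) # cs) \<beta>)"
        using b bs r True gen_eq_context[of "[]" r "[Elem b, Elem c]" "[Elem (b \<otimes> c)]"]
        by (simp add: bs_eq alt Elem)
      then show ?thesis
        using lw \<beta> bs b by (intro bexI[of _ 0] bexI[of _ \<beta>] exI[of _ "(b \<otimes> c) # cs"]) (auto simp: bs_eq)
    next
      case False
      then have "l # alternating_word \<alpha> bs \<beta> = alternating_word 0 (b # bs) \<beta>"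
        using \<alpha> by (simp add: Elem alternating_word_def interleave_Cons bs_eq)
      then show ?thesis
        using lw \<beta> bs b by (intro bexI[of _ 0] bexI[of _ \<beta>] exI[of _ "b # bs"]) auto
    qed
  qed
qed

text \<open>
  Up to three adjacent letters \<open>P\<close> meet at the joint and collapse to one, which is the separator
  between the last letter of \<open>bs\<close> and the first letter of \<open>cs\<close>.
\<close>

lemma gen_alternating_join:
  assumes "\<beta> \<in> {0, 1}" "\<gamma> \<in> {0, 1}" "set bs \<subseteq> carrier B" "set cs \<subseteq> carrier B" "bs \<noteq> []" "cs \<noteq> []"
  shows "words.gen (alternating_word \<alpha> bs \<beta> @ [Proj] @ alternating_word \<gamma> cs \<delta>)
    = words.gen (alternating_word \<alpha> (bs @ cs) \<delta>)"
proof -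
  let ?u = "replicate \<alpha> Proj @ interleave Proj (map Elem bs)"
  let ?v = "interleave Proj (map Elem cs) @ replicate \<delta> Proj"
  have u: "?u \<in> carrier (word_monoid B)" and v: "?v \<in> carrier (word_monoid B)"
    using alternating_word_closed[OF assms(3), of \<alpha> 0] alternating_word_closed[OF assms(4), of 0 \<delta>]
    by (simp_all add: alternating_word_def)
  have PP: "words.gen [Proj, Proj] = words.gen [Proj]"
    using ext_P_idem gen_append[of "[Proj]" "[Proj]"] by (simp add: ext_P_eq)
  then have PPP: "words.gen [Proj, Proj, Proj] = words.gen [Proj]"
    using gen_append[of "[Proj]" "[Proj, Proj]"] gen_append[of "[Proj]" "[Proj]"] by simp
  consider "\<beta> = 0 \<and> \<gamma> = 0" | "\<beta> = 0 \<and> \<gamma> = 1" | "\<beta> = 1 \<and> \<gamma> = 0" | "\<beta> = 1 \<and> \<gamma> = 1"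
    using assms(1,2) by blast
  then have "words.gen (replicate \<beta> Proj @ [Proj] @ replicate \<gamma> Proj) = words.gen [Proj]"
    by cases (simp_all add: PP PPP)
  from gen_eq_context[OF u v _ _ this] show ?thesis
    using assms(1,2,5,6) by (auto simp add: alternating_word_def interleave_append)
qed

text \<open>
  The extension acts on \<open>B\<close> from the left: elements of \<open>B\<close> by multiplication and \<open>P\<close> as the rank-one
  projection \<open>b \<mapsto> \<phi> b 1\<close>. The extended state is the vector state \<open>x \<mapsto> \<phi> (x 1)\<close> of this
  representation.
\<close>

fun act :: "('a \<Rightarrow> complex) \<Rightarrow> 'a letter \<Rightarrow> 'a \<Rightarrow> 'a" where
  "act \<phi> (Elem b) x = b \<otimes> x"
| "act \<phi> Proj x = \<phi> x \<odot> \<one>"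

lemma foldr_act_linear:
  assumes \<phi>: "state B \<phi>" and w: "w \<in> carrier (word_monoid B)"
  shows "x \<in> carrier B \<Longrightarrow> foldr (act \<phi>) w x \<in> carrier B"
    and "x \<in> carrier B \<Longrightarrow> y \<in> carrier B \<Longrightarrow>
      foldr (act \<phi>) w (x \<oplus> y) = foldr (act \<phi>) w x \<oplus> foldr (act \<phi>) w y"
    and "x \<in> carrier B \<Longrightarrow> foldr (act \<phi>) w (c \<odot> x) = c \<odot> foldr (act \<phi>) w x"
proof -
  have lin: "linear_functional B \<phi>" using \<phi> by (simp add: state_def)
  have closed: "foldr (act \<phi>) w x \<in> carrier B"
    if "x \<in> carrier B" "w \<in> carrier (word_monoid B)" for x w
    using that by (induction w) auto
  then show "x \<in> carrier B \<Longrightarrow> foldr (act \<phi>) w x \<in> carrier B" using w by blast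
  show "foldr (act \<phi>) w (x \<oplus> y) = foldr (act \<phi>) w x \<oplus> foldr (act \<phi>) w y"
    if x: "x \<in> carrier B" and y: "y \<in> carrier B"
    using w
  proof (induction w)
    case (Cons l w)
    then show ?case using closed[OF x, of w] closed[OF y, of w]
      by (auto simp: r_distr linear_functionalD[OF lin] scale_distrib_left)
  qed simp
  show "foldr (act \<phi>) w (c \<odot> x) = c \<odot> foldr (act \<phi>) w x" if x: "x \<in> carrier B"
    using w
  proof (induction w)
    case (Cons l w)
    then show ?case using closed[OF x, of w]
      by (auto simp: scale_mult_right linear_functionalD[OF lin] scale_scale)
  qed simp
qed

lemma act_alternating:
  assumes \<phi>: "state B \<phi>" and bs: "set bs \<subseteq> carrier B" "bs \<noteq> []" and \<beta>: "\<beta> \<in> {0, 1}" and \<alpha>: "\<alpha> \<in> {0, 1}"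
  shows "\<phi> (foldr (act \<phi>) (alternating_word \<alpha> bs \<beta>) \<one>) = prod_list (map \<phi> bs)"
proof -
  have lin: "linear_functional B \<phi>" and one: "\<phi> \<one> = 1" using \<phi> by (simp_all add: state_def)
  (* A trailing \<open>P\<close> has no effect, because it fixes the vector 1. *)
  have start: "foldr (act \<phi>) (replicate \<beta> Proj) \<one> = \<one>"
    using \<beta> one by (auto simp: scale_one)
  have inner: "foldr (act \<phi>) (interleave Proj (map Elem (b # bs))) \<one> = prod_list (map \<phi> bs) \<odot> b"
    if "b \<in> carrier B" "set bs \<subseteq> carrier B" for b bs
    using that
  proof (induction bs arbitrary: b)
    case Nil
    then show ?case by (simp add: scale_one)
  next
    case (Cons c cs)
    then show ?case
      by (simp add: linear_functionalD[OF lin] scale_mult_right mult.commute)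
  qed
  obtain c cs where "bs = c # cs" using bs by (cases bs) auto
  then have "foldr (act \<phi>) (interleave Proj (map Elem bs)) \<one> \<in> carrier B"
    and "\<phi> (foldr (act \<phi>) (interleave Proj (map Elem bs)) \<one>) = prod_list (map \<phi> bs)"
    using bs inner[of c cs] by (auto simp: linear_functionalD[OF lin])
  then show ?thesis
    using \<alpha> one by (auto simp: alternating_word_def start linear_functionalD[OF lin] simp del: foldr_replicate)
qed

text \<open>
  The vector state of the representation satisfies the relations of the extension, since the
  operators of the representation do.
\<close>

lemma extended_state_exists:
  assumes \<phi>: "state B \<phi>"
  shows "\<exists>f. linear_functional (extension B) f \<and> f (ext_P B) = 1 \<and>
     (\<forall>\<alpha>\<in>{0, 1}. \<forall>\<beta>\<in>{0, 1}. \<forall>bs. bs \<noteq> [] \<and> set bs \<subseteq> carrier B \<longrightarrow>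
        f (list_product (extension B)
             (replicate \<alpha> (ext_P B) @ interleave (ext_P B) (map (ext_emb B) bs)
                @ replicate \<beta> (ext_P B)))
          = prod_list (map \<phi> bs))"
proof -
  have lin: "linear_functional B \<phi>" and one: "\<phi> \<one> = 1" using \<phi> by (simp_all add: state_def)
  define \<Phi> where "\<Phi> w = \<phi> (foldr (act \<phi>) w \<one>)" for w
  have "linear_extension (\<lambda>w. \<Phi> (u \<otimes>\<^bsub>word_monoid B\<^esub> w \<otimes>\<^bsub>word_monoid B\<^esub> v)) r
      = linear_extension (\<lambda>w. \<Phi> (u \<otimes>\<^bsub>word_monoid B\<^esub> w \<otimes>\<^bsub>word_monoid B\<^esub> v)) s"
    if rs: "(r, s) \<in> extension_relations B"
      and u: "u \<in> carrier (word_monoid B)" and v: "v \<in> carrier (word_monoid B)" for r s u v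
  proof -
    define z where "z = foldr (act \<phi>) v \<one>"
    have z: "z \<in> carrier B" unfolding z_def using foldr_act_linear(1)[OF \<phi> v] by simp
    have \<Phi>: "\<Phi> (u @ w @ v) = \<phi> (foldr (act \<phi>) u (foldr (act \<phi>) w z))" for w
      by (simp add: \<Phi>_def z_def)
    consider
      (add) x y where "r = basis [Elem (x \<oplus> y)]"
        "s = basis [Elem x] \<oplus>\<^bsub>words.F\<^esub> basis [Elem y]" "x \<in> carrier B" "y \<in> carrier B"
    | (scale) c x where "r = basis [Elem (c \<odot> x)]" "s = c \<odot>\<^bsub>words.F\<^esub> basis [Elem x]"
        "x \<in> carrier B"
    | (mult) x y where "r = basis [Elem (x \<otimes> y)]" "s = basis [Elem x, Elem y]"
        "x \<in> carrier B" "y \<in> carrier B"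
    | (one) "r = basis [Elem \<one>]" "s = basis []"
    | (idem) "r = basis [Proj, Proj]" "s = basis [Proj]"
      using rs unfolding extension_relations_def Let_def by blast
    then show ?thesis
    proof cases
      case add
      then show ?thesis
        using z foldr_act_linear(1)[OF \<phi> u]
        by (simp add: \<Phi> words.monoid_algebra_simps linear_extension_add finite_support_simps
            l_distr foldr_act_linear(2)[OF \<phi> u] linear_functionalD(1)[OF lin])
    next
      case scale
      then show ?thesis
        using z foldr_act_linear(1)[OF \<phi> u]
        by (simp add: \<Phi> words.monoid_algebra_simps linear_extension_scale scale_mult_left
            foldr_act_linear(3)[OF \<phi> u] linear_functionalD(2)[OF lin])
    next
      case mult
      then show ?thesis using z by (simp add: \<Phi> m_assoc)
    next
      case one
      then show ?thesis using z by (simp add: \<Phi>)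
    next
      case idem
      then show ?thesis
        using z by (simp add: \<Phi> linear_functionalD(2)[OF lin] \<open>\<phi> \<one> = 1\<close>)
    qed
  qed
  then obtain f where f: "linear_functional words.T f"
    and f_gen: "\<And>w. w \<in> carrier (word_monoid B) \<Longrightarrow> f (words.gen w) = \<Phi> w"
    using words.functional_exists[of \<Phi>] by blast
  have P: "f (ext_P B) = 1"
    using one f_gen[of "[Proj]"] by (simp add: ext_P_eq \<Phi>_def scale_one)
  show ?thesis
  proof (intro exI[of _ f] conjI ballI allI impI)
    show "linear_functional (extension B) f" using f by (simp add: extension_eq)
    show "f (ext_P B) = 1" by (rule P)
  next
    fix \<alpha> \<beta> :: nat and bs assume *: "\<alpha> \<in> {0, 1}" "\<beta> \<in> {0, 1}" "bs \<noteq> [] \<and> set bs \<subseteq> carrier B"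
    then have "f (words.gen (alternating_word \<alpha> bs \<beta>))
        = \<phi> (foldr (act \<phi>) (alternating_word \<alpha> bs \<beta>) \<one>)"
      unfolding \<Phi>_def[symmetric] by (intro f_gen alternating_word_closed) simp
    also have "\<dots> = prod_list (map \<phi> bs)"
      using * by (intro act_alternating[OF \<phi>]) auto
    finally have "f (words.gen (alternating_word \<alpha> bs \<beta>)) = prod_list (map \<phi> bs)" .
    then show "f (list_product (extension B)
             (replicate \<alpha> (ext_P B) @ interleave (ext_P B) (map (ext_emb B) bs)
                @ replicate \<beta> (ext_P B)))
          = prod_list (map \<phi> bs)"
      using * list_product_alternating[of bs \<alpha> \<beta>] by simp
  qed
qed

lemma extended_state:
  assumes \<phi>: "state B \<phi>"
  shows linear_extended_state: "linear_functional (extension B) (extended_state B \<phi>)"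
    and extended_state_P: "extended_state B \<phi> (ext_P B) = 1"
    and extended_state_alternating: "\<And>\<alpha> \<beta> bs. \<alpha> \<in> {0, 1} \<Longrightarrow> \<beta> \<in> {0, 1} \<Longrightarrow> bs \<noteq> [] \<Longrightarrow>
      set bs \<subseteq> carrier B \<Longrightarrow>
      extended_state B \<phi> (words.gen (alternating_word \<alpha> bs \<beta>)) = prod_list (map \<phi> bs)"
proof -
  note spec = someI_ex[OF extended_state_exists[OF \<phi>], folded extended_state_def]
  show "linear_functional (extension B) (extended_state B \<phi>)" "extended_state B \<phi> (ext_P B) = 1"
    using spec by blast+
  show "extended_state B \<phi> (words.gen (alternating_word \<alpha> bs \<beta>)) = prod_list (map \<phi> bs)"
    if "\<alpha> \<in> {0, 1}" "\<beta> \<in> {0, 1}" "bs \<noteq> []" "set bs \<subseteq> carrier B" for \<alpha> \<beta> bs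
    using spec that list_product_alternating[of bs \<alpha> \<beta>] by auto
qed

lemma extended_state_emb:
  assumes "state B \<phi>" "b \<in> carrier B"
  shows "extended_state B \<phi> (ext_emb B b) = \<phi> b"
  using extended_state_alternating[OF assms(1), of 0 0 "[b]"] assms(2)
  by (simp add: alternating_word_def ext_emb_eq)

lemma extended_state_one: "state B \<phi> \<Longrightarrow> extended_state B \<phi> \<one>\<^bsub>extension B\<^esub> = 1"
  using extended_state_emb[of \<phi> \<one>] by (simp add: ext_emb_one state_def)

text \<open>
  The factorization at a letter \<open>P\<close> that drives the whole argument. On alternating words it is the
  defining formula, because joining two words at \<open>P\<close> concatenates their lists of letters from \<open>B\<close>.
  Choosing \<open>x\<close> or \<open>y\<close> as the unit shows that an outer factor \<open>P\<close> is invisible to the state.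
\<close>

lemma extended_state_P_between:
  assumes \<phi>: "state B \<phi>" and x: "x \<in> carrier (extension B)" and y: "y \<in> carrier (extension B)"
  shows "extended_state B \<phi> (x \<otimes>\<^bsub>extension B\<^esub> ext_P B \<otimes>\<^bsub>extension B\<^esub> y)
    = extended_state B \<phi> x * extended_state B \<phi> y"
proof -
  let ?f = "extended_state B \<phi>"
  note lin = linear_functionalD[OF linear_extended_state[OF \<phi>]]
  have gens: "?f (words.gen u \<otimes>\<^bsub>extension B\<^esub> ext_P B \<otimes>\<^bsub>extension B\<^esub> words.gen v)
      = ?f (words.gen u) * ?f (words.gen v)"
    if u: "u \<in> carrier (word_monoid B)" and v: "v \<in> carrier (word_monoid B)" for u v
  proof -
    obtain \<alpha> \<beta> bs where 1: "\<alpha> \<in> {0, 1::nat}" "\<beta> \<in> {0, 1::nat}" "bs \<noteq> []" "set bs \<subseteq> carrier B"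
      and u': "words.gen u = words.gen (alternating_word \<alpha> bs \<beta>)"
      using gen_alternating[OF u] by blast
    obtain \<gamma> \<delta> cs where 2: "\<gamma> \<in> {0, 1::nat}" "\<delta> \<in> {0, 1::nat}" "cs \<noteq> []" "set cs \<subseteq> carrier B"
      and v': "words.gen v = words.gen (alternating_word \<gamma> cs \<delta>)"
      using gen_alternating[OF v] by blast
    let ?u = "alternating_word \<alpha> bs \<beta>" and ?v = "alternating_word \<gamma> cs \<delta>"
    have "words.gen u \<otimes>\<^bsub>extension B\<^esub> ext_P B \<otimes>\<^bsub>extension B\<^esub> words.gen v
        = words.gen (?u @ [Proj] @ ?v)"
      using alternating_word_closed[OF 1(4), of \<alpha> \<beta>] alternating_word_closed[OF 2(4), of \<gamma> \<delta>]
        gen_append[of "?u @ [Proj]" ?v] gen_append[of ?u "[Proj]"]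
      by (simp add: u' v' ext_P_eq)
    also have "\<dots> = words.gen (alternating_word \<alpha> (bs @ cs) \<delta>)"
      using 1 2 by (intro gen_alternating_join)
    also have "?f \<dots> = prod_list (map \<phi> (bs @ cs))"
      using 1 2 by (intro extended_state_alternating[OF \<phi>]) auto
    finally show ?thesis
      using extended_state_alternating[OF \<phi> 1] extended_state_alternating[OF \<phi> 2]
      by (simp add: u' v')
  qed
  let ?L = "\<lambda>x y. ?f (x \<otimes>\<^bsub>extension B\<^esub> ext_P B \<otimes>\<^bsub>extension B\<^esub> y)"
  have "linear_functional (extension B) (\<lambda>x. ?L x y)" "linear_functional (extension B) (?L y)"
    if "y \<in> carrier (extension B)" for y
    using that linear_extended_state[OF \<phi>] by (auto intro: ext.linear_functional_sandwich)
  moreover have "linear_functional (extension B) (\<lambda>x. ?f x * c)"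
    "linear_functional (extension B) (\<lambda>x. c * ?f x)" for c
    using lin by (auto simp: linear_functional_def algebra_simps)
  ultimately show ?thesis
    using words.bilinear_eqI[of ?L "\<lambda>x y. ?f x * ?f y" x y] gens x y
    by (simp add: extension_eq)
qed

end

section \<open>Restricted tensor products and product states\<close>

definition product_value :: "'i set \<Rightarrow> ('i \<Rightarrow> 'b \<Rightarrow> complex) \<Rightarrow> ('i \<Rightarrow> 'b) \<Rightarrow> complex" where
  "product_value I f x = (\<Prod>i | i \<in> I \<and> f i (x i) \<noteq> 1. f i (x i))"

text \<open>
  Only factors different from 1 enter \<^const>\<open>product_value\<close>, so two values are compared after
  enlarging their index sets to a common finite one.
\<close>

lemma product_value_superset:
  assumes "finite S" "S \<subseteq> I" "\<And>i. i \<in> I \<Longrightarrow> i \<notin> S \<Longrightarrow> f i (x i) = 1"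
  shows "product_value I f x = (\<Prod>i\<in>S. f i (x i))"
  unfolding product_value_def using assms by (intro prod.mono_neutral_left) auto

locale tensor_factors =
  fixes I :: "'i set" and T :: "'i \<Rightarrow> (complex, 'b) module" and E :: "'i \<Rightarrow> 'b set"
  assumes factor: "i \<in> I \<Longrightarrow> ring_over_complex (T i)"
    and base_closed: "i \<in> I \<Longrightarrow> E i \<subseteq> carrier (T i)"
    and base_one: "i \<in> I \<Longrightarrow> \<one>\<^bsub>T i\<^esub> \<in> E i"
    and base_mult: "i \<in> I \<Longrightarrow> u \<in> E i \<Longrightarrow> v \<in> E i \<Longrightarrow> u \<otimes>\<^bsub>T i\<^esub> v \<in> E i"
begin

text \<open>
  Membership in the tensor monoid up to extensionality, which \<^const>\<open>simple_tensor\<close> restores.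
\<close>

definition admissible :: "('i \<Rightarrow> 'b) \<Rightarrow> bool" where
  "admissible x \<longleftrightarrow> (\<forall>i\<in>I. x i \<in> carrier (T i)) \<and> finite {i \<in> I. x i \<notin> E i}"

lemma admissible_closed: "admissible x \<Longrightarrow> i \<in> I \<Longrightarrow> x i \<in> carrier (T i)"
  by (simp add: admissible_def)

lemma tensor_monoid_carrier:
  "x \<in> carrier (tensor_monoid I T E) \<longleftrightarrow> x \<in> extensional I \<and> admissible x"
  by (auto simp: tensor_monoid_def admissible_def PiE_def Pi_def)

lemma tensor_monoid_mult: "x \<otimes>\<^bsub>tensor_monoid I T E\<^esub> y = (\<lambda>i\<in>I. x i \<otimes>\<^bsub>T i\<^esub> y i)"
  by (simp add: tensor_monoid_def)

lemma tensor_monoid_one: "\<one>\<^bsub>tensor_monoid I T E\<^esub> = (\<lambda>i\<in>I. \<one>\<^bsub>T i\<^esub>)"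
  by (simp add: tensor_monoid_def)

lemma admissible_restrict [simp]: "admissible (restrict x I) \<longleftrightarrow> admissible x"
proof -
  have "{i \<in> I. restrict x I i \<notin> E i} = {i \<in> I. x i \<notin> E i}" by auto
  then show ?thesis by (simp add: admissible_def)
qed

lemma restrict_in_tensor_monoid [simp]:
  "restrict x I \<in> carrier (tensor_monoid I T E) \<longleftrightarrow> admissible x"
  by (simp add: tensor_monoid_carrier)

lemma admissible_base: "(\<And>i. i \<in> I \<Longrightarrow> x i \<in> E i) \<Longrightarrow> admissible x"
proof -
  assume x: "\<And>i. i \<in> I \<Longrightarrow> x i \<in> E i"
  then have empty: "{i \<in> I. x i \<notin> E i} = {}" by auto
  have "x i \<in> carrier (T i)" if "i \<in> I" for i
    using x[OF that] base_closed[OF that] by blast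
  then show ?thesis unfolding admissible_def empty by simp
qed

lemma admissible_update:
  assumes "admissible x" "i \<in> I" "u \<in> carrier (T i)"
  shows "admissible (x(i := u))"
proof -
  have "{k \<in> I. (x(i := u)) k \<notin> E k} \<subseteq> insert i {k \<in> I. x k \<notin> E k}" by auto
  then have "finite {k \<in> I. (x(i := u)) k \<notin> E k}"
    using assms(1) unfolding admissible_def by (meson finite_insert finite_subset)
  then show ?thesis using assms by (simp add: admissible_def)
qed

lemma admissible_mult:
  assumes "admissible x" "admissible y"
  shows "admissible (\<lambda>i. x i \<otimes>\<^bsub>T i\<^esub> y i)"
proof -
  have "{i \<in> I. x i \<otimes>\<^bsub>T i\<^esub> y i \<notin> E i} \<subseteq> {i \<in> I. x i \<notin> E i} \<union> {i \<in> I. y i \<notin> E i}"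
    using base_mult by auto
  then have "finite {i \<in> I. x i \<otimes>\<^bsub>T i\<^esub> y i \<notin> E i}"
    using assms unfolding admissible_def by (meson finite_UnI finite_subset)
  moreover have "x i \<otimes>\<^bsub>T i\<^esub> y i \<in> carrier (T i)" if i: "i \<in> I" for i
  proof -
    interpret ring_over_complex "T i" by (rule factor[OF i])
    show ?thesis using assms i by (simp add: admissible_def)
  qed
  ultimately show ?thesis by (simp add: admissible_def)
qed

lemma monoid_tensor_monoid: "monoid (tensor_monoid I T E)"
proof (rule monoidI)
  fix x y z
  assume xyz: "x \<in> carrier (tensor_monoid I T E)" "y \<in> carrier (tensor_monoid I T E)"
    "z \<in> carrier (tensor_monoid I T E)"
  then have adm: "admissible x" "admissible y" "admissible z"
    by (auto simp: tensor_monoid_carrier)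
  show "x \<otimes>\<^bsub>tensor_monoid I T E\<^esub> y \<in> carrier (tensor_monoid I T E)"
    by (simp add: tensor_monoid_mult admissible_mult adm)
  show "x \<otimes>\<^bsub>tensor_monoid I T E\<^esub> y \<otimes>\<^bsub>tensor_monoid I T E\<^esub> z
      = x \<otimes>\<^bsub>tensor_monoid I T E\<^esub> (y \<otimes>\<^bsub>tensor_monoid I T E\<^esub> z)"
    unfolding tensor_monoid_mult
  proof (rule restrict_ext)
    fix i assume i: "i \<in> I"
    interpret ring_over_complex "T i" by (rule factor[OF i])
    show "(\<lambda>i\<in>I. x i \<otimes>\<^bsub>T i\<^esub> y i) i \<otimes>\<^bsub>T i\<^esub> z i = x i \<otimes>\<^bsub>T i\<^esub> (\<lambda>i\<in>I. y i \<otimes>\<^bsub>T i\<^esub> z i) i"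
      using i adm by (simp add: admissible_closed m_assoc)
  qed
  have unit: "\<one>\<^bsub>T i\<^esub> \<otimes>\<^bsub>T i\<^esub> x i = x i" "x i \<otimes>\<^bsub>T i\<^esub> \<one>\<^bsub>T i\<^esub> = x i" if i: "i \<in> I" for i
  proof -
    interpret ring_over_complex "T i" by (rule factor[OF i])
    show "\<one>\<^bsub>T i\<^esub> \<otimes>\<^bsub>T i\<^esub> x i = x i" "x i \<otimes>\<^bsub>T i\<^esub> \<one>\<^bsub>T i\<^esub> = x i"
      using i adm by (simp_all add: admissible_closed)
  qed
  show "\<one>\<^bsub>tensor_monoid I T E\<^esub> \<otimes>\<^bsub>tensor_monoid I T E\<^esub> x = x"
    and "x \<otimes>\<^bsub>tensor_monoid I T E\<^esub> \<one>\<^bsub>tensor_monoid I T E\<^esub> = x"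
    using xyz unit by (auto simp: tensor_monoid_mult tensor_monoid_one tensor_monoid_carrier
        fun_eq_iff extensional_def)
qed (simp add: tensor_monoid_one admissible_base base_one)

sublocale tensors: monoid_with_algebra "tensor_monoid I T E"
  by (rule monoid_with_algebra.intro[OF monoid_tensor_monoid])

lemma tensor_relations_cases:
  assumes "(r, s) \<in> tensor_relations I T E"
  obtains (add) x i u v where "r = basis (x(i := u \<oplus>\<^bsub>T i\<^esub> v))"
      "s = basis (x(i := u)) \<oplus>\<^bsub>tensors.F\<^esub> basis (x(i := v))"
      "x \<in> carrier (tensor_monoid I T E)" "i \<in> I" "u \<in> carrier (T i)" "v \<in> carrier (T i)"
  | (scale) x i c u where "r = basis (x(i := c \<odot>\<^bsub>T i\<^esub> u))"
      "s = c \<odot>\<^bsub>tensors.F\<^esub> basis (x(i := u))"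
      "x \<in> carrier (tensor_monoid I T E)" "i \<in> I" "u \<in> carrier (T i)"
  using assms unfolding tensor_relations_def Let_def by blast

sublocale tensors: presented_algebra "tensor_monoid I T E" "tensor_relations I T E"
proof
  interpret F: ring_over_complex tensors.F by (rule tensors.ring_over_complex_monoid_algebra)
  have upd: "x(i := u) \<in> carrier (tensor_monoid I T E)"
    if "x \<in> carrier (tensor_monoid I T E)" "i \<in> I" "u \<in> carrier (T i)" for x i u
    using that by (auto simp: tensor_monoid_carrier admissible_update extensional_def)
  have ops: "u \<oplus>\<^bsub>T i\<^esub> v \<in> carrier (T i)" "c \<odot>\<^bsub>T i\<^esub> u \<in> carrier (T i)"
    if i: "i \<in> I" and "u \<in> carrier (T i)" "v \<in> carrier (T i)" for i u v c
  proof -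
    interpret ring_over_complex "T i" by (rule factor[OF i])
    show "u \<oplus>\<^bsub>T i\<^esub> v \<in> carrier (T i)" "c \<odot>\<^bsub>T i\<^esub> u \<in> carrier (T i)" using that by auto
  qed
  have "r \<in> carrier tensors.F \<and> s \<in> carrier tensors.F" if "(r, s) \<in> tensor_relations I T E" for r s
    using that by (cases rule: tensor_relations_cases) (simp_all add: upd ops)
  then show "tensor_relations I T E \<subseteq> carrier tensors.F \<times> carrier tensors.F" by auto
qed

lemma tensor_algebra_eq: "tensor_algebra I T E = tensors.T"
  by (simp add: tensor_algebra_def tensor_ideal_def)

abbreviation st where "st \<equiv> simple_tensor I T E"
abbreviation TA where "TA \<equiv> tensor_algebra I T E"

lemma simple_tensor_eq: "st x = tensors.gen (restrict x I)"
  by (simp add: simple_tensor_def tensor_ideal_def)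

sublocale TA: ring_over_complex "tensor_algebra I T E"
  unfolding tensor_algebra_eq by (rule tensors.ring_over_complex_T)

lemma simple_tensor_closed [simp, intro]: "admissible x \<Longrightarrow> st x \<in> carrier TA"
  by (simp add: tensor_algebra_eq simple_tensor_eq)

lemma simple_tensor_cong: "(\<And>i. i \<in> I \<Longrightarrow> x i = y i) \<Longrightarrow> st x = st y"
  unfolding simple_tensor_eq by (metis restrict_ext)

lemma simple_tensor_mult:
  assumes "admissible x" "admissible y"
  shows "st x \<otimes>\<^bsub>TA\<^esub> st y = st (\<lambda>i. x i \<otimes>\<^bsub>T i\<^esub> y i)"
proof -
  have "restrict x I \<otimes>\<^bsub>tensor_monoid I T E\<^esub> restrict y I = (\<lambda>i\<in>I. x i \<otimes>\<^bsub>T i\<^esub> y i)"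
    unfolding tensor_monoid_mult by (rule restrict_ext) simp
  then show ?thesis
    using assms tensors.gen_mult[of "restrict x I" "restrict y I"]
    by (simp add: tensor_algebra_eq simple_tensor_eq)
qed

lemma simple_tensor_one: "st (\<lambda>i. \<one>\<^bsub>T i\<^esub>) = \<one>\<^bsub>TA\<^esub>"
  using tensors.gen_one by (simp add: tensor_algebra_eq simple_tensor_eq tensor_monoid_one)

lemma restrict_update: "i \<in> I \<Longrightarrow> restrict (x(i := u)) I = (restrict x I)(i := u)"
  by (auto simp: fun_eq_iff)

lemma simple_tensor_add:
  assumes "admissible x" "i \<in> I" "u \<in> carrier (T i)" "v \<in> carrier (T i)"
  shows "st (x(i := u \<oplus>\<^bsub>T i\<^esub> v)) = st (x(i := u)) \<oplus>\<^bsub>TA\<^esub> st (x(i := v))"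
proof -
  let ?x = "restrict x I"
  have "?x \<in> carrier (tensor_monoid I T E)" using assms by simp
  then have "(basis (?x(i := u \<oplus>\<^bsub>T i\<^esub> v)),
      basis (?x(i := u)) \<oplus>\<^bsub>tensors.F\<^esub> basis (?x(i := v))) \<in> tensor_relations I T E"
    using assms(2-4) unfolding tensor_relations_def Let_def by blast
  moreover have "?x(i := u) \<in> carrier (tensor_monoid I T E)"
    "?x(i := v) \<in> carrier (tensor_monoid I T E)"
    using assms by (simp_all add: restrict_update[symmetric] admissible_update)
  ultimately show ?thesis
    using tensors.relation_holds assms(2)
    by (simp add: simple_tensor_eq tensor_algebra_eq restrict_update tensors.quotient.proj_ops)
qed

lemma simple_tensor_scale:
  assumes "admissible x" "i \<in> I" "u \<in> carrier (T i)"
  shows "st (x(i := c \<odot>\<^bsub>T i\<^esub> u)) = c \<odot>\<^bsub>TA\<^esub> st (x(i := u))"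
proof -
  let ?x = "restrict x I"
  have "?x \<in> carrier (tensor_monoid I T E)" using assms by simp
  then have "(basis (?x(i := c \<odot>\<^bsub>T i\<^esub> u)), c \<odot>\<^bsub>tensors.F\<^esub> basis (?x(i := u)))
      \<in> tensor_relations I T E"
    using assms(2-3) unfolding tensor_relations_def Let_def by blast
  moreover have "?x(i := u) \<in> carrier (tensor_monoid I T E)"
    using assms by (simp add: restrict_update[symmetric] admissible_update)
  ultimately show ?thesis
    using tensors.relation_holds assms(2)
    by (simp add: simple_tensor_eq tensor_algebra_eq restrict_update tensors.quotient.proj_scale)
qed

lemma tensor_functional_eqI:
  assumes "linear_functional TA F" "linear_functional TA G"
    and "\<And>x. admissible x \<Longrightarrow> F (st x) = G (st x)" and "z \<in> carrier TA"
  shows "F z = G z"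
proof -
  have "F (tensors.gen w) = G (tensors.gen w)" if "w \<in> carrier (tensor_monoid I T E)" for w
    using assms(3)[of w] that by (simp add: simple_tensor_eq tensor_monoid_carrier extensional_restrict)
  then show ?thesis
    using assms(1,2,4) unfolding tensor_algebra_eq by (intro tensors.functional_eqI[of F G z])
qed

lemma tensor_bilinear_eqI:
  assumes "\<And>y. y \<in> carrier TA \<Longrightarrow> linear_functional TA (\<lambda>x. L x y)"
    and "\<And>x. x \<in> carrier TA \<Longrightarrow> linear_functional TA (L x)"
    and "\<And>y. y \<in> carrier TA \<Longrightarrow> linear_functional TA (\<lambda>x. M x y)"
    and "\<And>x. x \<in> carrier TA \<Longrightarrow> linear_functional TA (M x)"
    and "\<And>s t. admissible s \<Longrightarrow> admissible t \<Longrightarrow> L (st s) (st t) = M (st s) (st t)"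
    and "x \<in> carrier TA" "y \<in> carrier TA"
  shows "L x y = M x y"
proof -
  have "L x (st t) = M x (st t)" if "admissible t" for t
    using assms that by (intro tensor_functional_eqI[of "\<lambda>x. L x (st t)" "\<lambda>x. M x (st t)" x]) auto
  then show ?thesis
    using assms by (intro tensor_functional_eqI[of "L x" "M x" y]) auto
qed

end

locale tensor_functionals = tensor_factors I T E
  for I :: "'i set" and T :: "'i \<Rightarrow> (complex, 'b) module" and E +
  fixes f :: "'i \<Rightarrow> 'b \<Rightarrow> complex"
  assumes linear: "i \<in> I \<Longrightarrow> linear_functional (T i) (f i)"
    and base_value: "i \<in> I \<Longrightarrow> u \<in> E i \<Longrightarrow> f i u = 1"
begin

text \<open>
  The two rules by which product states are computed below: changing one factor by a scalar changes
  the value by this scalar, and factorwise products give products.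
\<close>

lemma product_value_rescale:
  assumes x: "admissible x" and y: "admissible y" and i: "i \<in> I"
    and at_i: "f i (x i) = c * f i (y i)"
    and off_i: "\<And>k. k \<in> I \<Longrightarrow> k \<noteq> i \<Longrightarrow> f k (x k) = f k (y k)"
  shows "product_value I f x = c * product_value I f y"
proof -
  let ?S = "insert i ({k \<in> I. x k \<notin> E k} \<union> {k \<in> I. y k \<notin> E k})"
  have S: "finite ?S" "?S \<subseteq> I" using x y i by (auto simp: admissible_def)
  have "product_value I f x = (\<Prod>k\<in>?S. f k (x k))"
    by (rule product_value_superset[OF S]) (use base_value in auto)
  also have "\<dots> = f i (x i) * (\<Prod>k\<in>?S - {i}. f k (x k))"
    using S by (intro prod.remove) auto
  also have "(\<Prod>k\<in>?S - {i}. f k (x k)) = (\<Prod>k\<in>?S - {i}. f k (y k))"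
    using S off_i by (intro prod.cong) auto
  also have "f i (x i) * (\<Prod>k\<in>?S - {i}. f k (y k)) = c * (f i (y i) * (\<Prod>k\<in>?S - {i}. f k (y k)))"
    by (simp add: at_i)
  also have "f i (y i) * (\<Prod>k\<in>?S - {i}. f k (y k)) = (\<Prod>k\<in>?S. f k (y k))"
    using S by (intro prod.remove[symmetric]) auto
  also have "\<dots> = product_value I f y"
    by (rule product_value_superset[OF S, symmetric]) (use base_value in auto)
  finally show ?thesis .
qed

lemma product_value_mult:
  assumes x: "admissible x" and y: "admissible y"
    and "\<And>i. i \<in> I \<Longrightarrow> f i (z i) = f i (x i) * f i (y i)"
  shows "product_value I f z = product_value I f x * product_value I f y"
proof -
  let ?S = "{k \<in> I. x k \<notin> E k} \<union> {k \<in> I. y k \<notin> E k}"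
  have S: "finite ?S" "?S \<subseteq> I" using x y by (auto simp: admissible_def)
  have "product_value I f z = (\<Prod>k\<in>?S. f k (z k))"
    by (rule product_value_superset[OF S]) (use base_value assms(3) in auto)
  also have "\<dots> = (\<Prod>k\<in>?S. f k (x k)) * (\<Prod>k\<in>?S. f k (y k))"
    unfolding prod.distrib[symmetric] using assms(3) by (intro prod.cong) auto
  also have "(\<Prod>k\<in>?S. f k (x k)) = product_value I f x"
    by (rule product_value_superset[OF S, symmetric]) (use base_value in auto)
  also have "(\<Prod>k\<in>?S. f k (y k)) = product_value I f y"
    by (rule product_value_superset[OF S, symmetric]) (use base_value in auto)
  finally show ?thesis .
qed

lemma product_value_update:
  assumes "admissible x" "i \<in> I" "u \<in> carrier (T i)"
  shows "product_value I f (x(i := u)) = f i u * product_value I f (x(i := \<one>\<^bsub>T i\<^esub>))"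
  using assms base_closed base_one
  by (intro product_value_rescale[of _ _ i]) (auto intro!: admissible_update simp: base_value)

lemma product_value_restrict: "product_value I f (restrict x I) = product_value I f x"
  unfolding product_value_def by (intro prod.cong) auto

text \<open>
  Multiplying a family from both sides acts on each coordinate separately, so inside any context the
  value depends linearly on the coordinate that a multilinearity relation changes.
\<close>

lemma product_state_exists:
  "\<exists>F. linear_functional TA F \<and>
     (\<forall>x\<in>carrier (tensor_monoid I T E). F (st x) = (\<Prod>i | i \<in> I \<and> f i (x i) \<noteq> 1. f i (x i)))"
proof -
  let ?M = "tensor_monoid I T E"
  let ?\<Phi> = "product_value I f"
  (* the coordinate at \<open>i\<close> is the only one that feels the update *)
  have update: "y \<otimes>\<^bsub>?M\<^esub> x(i := u) \<otimes>\<^bsub>?M\<^esub> z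
      = (y \<otimes>\<^bsub>?M\<^esub> x \<otimes>\<^bsub>?M\<^esub> z)(i := y i \<otimes>\<^bsub>T i\<^esub> u \<otimes>\<^bsub>T i\<^esub> z i)" if "i \<in> I" for x y z i u
    using that by (auto simp: tensor_monoid_mult fun_eq_iff)
  have "linear_extension (\<lambda>w. ?\<Phi> (y \<otimes>\<^bsub>?M\<^esub> w \<otimes>\<^bsub>?M\<^esub> z)) r
      = linear_extension (\<lambda>w. ?\<Phi> (y \<otimes>\<^bsub>?M\<^esub> w \<otimes>\<^bsub>?M\<^esub> z)) s"
    if rs: "(r, s) \<in> tensor_relations I T E"
      and y: "y \<in> carrier ?M" and z: "z \<in> carrier ?M" for r s y z
  proof -
    have val: "?\<Phi> (y \<otimes>\<^bsub>?M\<^esub> x(i := u) \<otimes>\<^bsub>?M\<^esub> z) = f i (y i \<otimes>\<^bsub>T i\<^esub> u \<otimes>\<^bsub>T i\<^esub> z i)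
          * ?\<Phi> ((y \<otimes>\<^bsub>?M\<^esub> x \<otimes>\<^bsub>?M\<^esub> z)(i := \<one>\<^bsub>T i\<^esub>))"
      if i: "i \<in> I" and x: "x \<in> carrier ?M" and u: "u \<in> carrier (T i)" for x i u
    proof -
      interpret ring_over_complex "T i" by (rule factor[OF i])
      have "y \<otimes>\<^bsub>?M\<^esub> x \<otimes>\<^bsub>?M\<^esub> z \<in> carrier ?M" using x y z by simp
      then have "admissible (y \<otimes>\<^bsub>?M\<^esub> x \<otimes>\<^bsub>?M\<^esub> z)" by (simp only: tensor_monoid_carrier)
      moreover have "y i \<in> carrier (T i)" "z i \<in> carrier (T i)"
        using y z i by (auto simp: tensor_monoid_carrier admissible_closed)
      ultimately show ?thesis
        using i u by (simp only: update[OF i]) (intro product_value_update, auto)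
    qed
    show ?thesis
      using rs
    proof (cases rule: tensor_relations_cases)
      case (add x i u v)
      interpret ring_over_complex "T i" by (rule factor[OF \<open>i \<in> I\<close>])
      have "y i \<in> carrier (T i)" "z i \<in> carrier (T i)"
        using y z \<open>i \<in> I\<close> by (auto simp: tensor_monoid_carrier admissible_closed)
      then have "f i (y i \<otimes>\<^bsub>T i\<^esub> (u \<oplus>\<^bsub>T i\<^esub> v) \<otimes>\<^bsub>T i\<^esub> z i)
          = f i (y i \<otimes>\<^bsub>T i\<^esub> u \<otimes>\<^bsub>T i\<^esub> z i) + f i (y i \<otimes>\<^bsub>T i\<^esub> v \<otimes>\<^bsub>T i\<^esub> z i)"
        using add linear_functionalD(1)[OF linear[OF \<open>i \<in> I\<close>]] by (simp add: l_distr r_distr)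
      then show ?thesis
        using add by (simp add: tensors.monoid_algebra_simps linear_extension_add
            finite_support_simps val distrib_right)
    next
      case (scale x i c u)
      interpret ring_over_complex "T i" by (rule factor[OF \<open>i \<in> I\<close>])
      have "y i \<in> carrier (T i)" "z i \<in> carrier (T i)"
        using y z \<open>i \<in> I\<close> by (auto simp: tensor_monoid_carrier admissible_closed)
      then have "f i (y i \<otimes>\<^bsub>T i\<^esub> (c \<odot>\<^bsub>T i\<^esub> u) \<otimes>\<^bsub>T i\<^esub> z i) = c * f i (y i \<otimes>\<^bsub>T i\<^esub> u \<otimes>\<^bsub>T i\<^esub> z i)"
        using scale linear_functionalD(2)[OF linear[OF \<open>i \<in> I\<close>]]
        by (simp add: scale_mult_left scale_mult_right)
      then show ?thesis
        using scale by (simp add: tensors.monoid_algebra_simps linear_extension_scale val)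
    qed
  qed
  then obtain F where "linear_functional tensors.T F"
    and "\<And>w. w \<in> carrier ?M \<Longrightarrow> F (tensors.gen w) = ?\<Phi> w"
    using tensors.functional_exists[of ?\<Phi>] by blast
  then show ?thesis
    by (intro exI[of _ F])
      (auto simp: tensor_algebra_eq simple_tensor_eq product_value_def tensor_monoid_carrier
        extensional_restrict)
qed

abbreviation pst where "pst \<equiv> product_state I T E f"

lemma linear_product_state: "linear_functional TA pst"
  using someI_ex[OF product_state_exists, folded product_state_def] by blast

lemma product_state_simple_tensor:
  assumes "admissible x"
  shows "pst (st x) = product_value I f x"
proof -
  have "pst (st (restrict x I)) = product_value I f (restrict x I)"
    using someI_ex[OF product_state_exists, folded product_state_def] assms
    unfolding product_value_def by simp
  moreover have "st (restrict x I) = st x" by (rule simple_tensor_cong) simp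
  ultimately show ?thesis by (simp add: product_value_restrict)
qed

lemma product_state_base: "(\<And>i. i \<in> I \<Longrightarrow> x i \<in> E i) \<Longrightarrow> pst (st x) = 1"
  using product_value_superset[of "{}" I f x] base_value
  by (simp add: product_state_simple_tensor admissible_base)

lemma state_product_state: "state TA pst"
  using linear_product_state product_state_base[of "\<lambda>i. \<one>\<^bsub>T i\<^esub>"] base_one
  by (simp add: state_def simple_tensor_one)

end

section \<open>Replicas\<close>

text \<open>
  The shape of a product of two replicas. The hypotheses reflect the orthogonality of \<open>p\<close> and
  \<open>p' - p\<close>; under them six of the nine terms cancel in pairs.
\<close>

lemma (in ring_over_complex) orthogonal_sum_mult:
  assumes "x1 \<in> carrier A" "x2 \<in> carrier A" "x3 \<in> carrier A"
    and "y1 \<in> carrier A" "y2 \<in> carrier A" "y3 \<in> carrier A"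
    and "x1 \<otimes> y2 = x1 \<otimes> y3" "x2 \<otimes> y1 = x3 \<otimes> y1" "x2 \<otimes> y3 = x3 \<otimes> y3" "x3 \<otimes> y2 = x3 \<otimes> y3"
  shows "(x1 \<oplus> (x2 \<ominus> x3)) \<otimes> (y1 \<oplus> (y2 \<ominus> y3)) = x1 \<otimes> y1 \<oplus> (x2 \<otimes> y2 \<ominus> x3 \<otimes> y3)"
proof -
  have diff: "u \<ominus> u = \<zero>" if "u \<in> carrier A" for u
    using that by (simp add: a_minus_def r_neg)
  have left: "u \<otimes> (v \<ominus> w) = u \<otimes> v \<ominus> u \<otimes> w"
    if "u \<in> carrier A" "v \<in> carrier A" "w \<in> carrier A" for u v w
    using that by (simp add: a_minus_def r_distr r_minus)
  have right: "(v \<ominus> w) \<otimes> u = v \<otimes> u \<ominus> w \<otimes> u"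
    if "u \<in> carrier A" "v \<in> carrier A" "w \<in> carrier A" for u v w
    using that by (simp add: a_minus_def l_distr l_minus)
  have 1: "x1 \<otimes> (y2 \<ominus> y3) = \<zero>" "(x2 \<ominus> x3) \<otimes> y1 = \<zero>"
    using assms by (simp_all add: left right diff)
  have 2: "(x2 \<ominus> x3) \<otimes> (y2 \<ominus> y3) = x2 \<otimes> y2 \<ominus> x3 \<otimes> y3"
    using assms by (simp add: left right diff) (simp add: a_minus_def)
  have "(x1 \<oplus> (x2 \<ominus> x3)) \<otimes> (y1 \<oplus> (y2 \<ominus> y3))
      = (x1 \<otimes> y1 \<oplus> x1 \<otimes> (y2 \<ominus> y3)) \<oplus> ((x2 \<ominus> x3) \<otimes> y1 \<oplus> (x2 \<ominus> x3) \<otimes> (y2 \<ominus> y3))"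
    using assms(1-6) by (simp add: l_distr r_distr a_ac)
  then show ?thesis using assms(1-6) unfolding 1 2 by simp
qed

locale algebra_family =
  fixes J :: "'j::linorder set" and A :: "'j \<Rightarrow> (complex, 'a) module"
  assumes algebra: "j \<in> J \<Longrightarrow> ring_over_complex (A j)"
begin

abbreviation one where "one j \<equiv> \<one>\<^bsub>extension (A j)\<^esub>"
abbreviation P where "P j \<equiv> ext_P (A j)"
abbreviation emb where "emb j a \<equiv> ext_emb (A j) a"

lemma idempotent_extension: "j \<in> J \<Longrightarrow> idempotent_extension (A j)"
  by (intro idempotent_extension.intro algebra)

lemma extension_algebra: "j \<in> J \<Longrightarrow> ring_over_complex (extension (A j))"
proof -
  assume j: "j \<in> J"
  interpret idempotent_extension "A j" by (rule idempotent_extension[OF j])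
  show ?thesis by (rule ext.ring_over_complex_axioms)
qed

lemma extension_closed [simp]:
  assumes "j \<in> J"
  shows "one j \<in> carrier (extension (A j))" "P j \<in> carrier (extension (A j))"
    "a \<in> carrier (A j) \<Longrightarrow> emb j a \<in> carrier (extension (A j))"
    "x \<in> carrier (extension (A j)) \<Longrightarrow> y \<in> carrier (extension (A j)) \<Longrightarrow>
      x \<otimes>\<^bsub>extension (A j)\<^esub> y \<in> carrier (extension (A j))"
proof -
  interpret idempotent_extension "A j" by (rule idempotent_extension[OF assms])
  show "one j \<in> carrier (extension (A j))" "P j \<in> carrier (extension (A j))"
    "a \<in> carrier (A j) \<Longrightarrow> emb j a \<in> carrier (extension (A j))"
    "x \<in> carrier (extension (A j)) \<Longrightarrow> y \<in> carrier (extension (A j)) \<Longrightarrow>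
      x \<otimes>\<^bsub>extension (A j)\<^esub> y \<in> carrier (extension (A j))" by auto
qed

lemma extension_mult [simp]:
  assumes "j \<in> J"
  shows "x \<in> carrier (extension (A j)) \<Longrightarrow> one j \<otimes>\<^bsub>extension (A j)\<^esub> x = x"
    "x \<in> carrier (extension (A j)) \<Longrightarrow> x \<otimes>\<^bsub>extension (A j)\<^esub> one j = x"
    "P j \<otimes>\<^bsub>extension (A j)\<^esub> P j = P j"
proof -
  interpret idempotent_extension "A j" by (rule idempotent_extension[OF assms])
  show "x \<in> carrier (extension (A j)) \<Longrightarrow> one j \<otimes>\<^bsub>extension (A j)\<^esub> x = x"
    "x \<in> carrier (extension (A j)) \<Longrightarrow> x \<otimes>\<^bsub>extension (A j)\<^esub> one j = x"
    "P j \<otimes>\<^bsub>extension (A j)\<^esub> P j = P j" by (auto simp: ext_P_idem)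
qed

lemma in_factor_set [simp]: "(j, s) \<in> factor_set J \<longleftrightarrow> j \<in> J"
  by (simp add: factor_set_def)

lemma factor_simps [simp]:
  "factor_algebra A (j, s) = extension (A j)" "factor_base A (j, s) = {one j, P j}"
  by (simp_all add: factor_algebra_def factor_base_def)

sublocale tensor_factors "factor_set J" "factor_algebra A" "factor_base A"
proof (rule tensor_factors.intro)
  fix i u v assume i: "i \<in> factor_set J"
  obtain j s where js: "i = (j, s)" by (cases i)
  with i have j: "j \<in> J" by simp
  show "ring_over_complex (factor_algebra A i)" using j by (simp add: js extension_algebra)
  show "factor_base A i \<subseteq> carrier (factor_algebra A i)" using j by (simp add: js)
  show "\<one>\<^bsub>factor_algebra A i\<^esub> \<in> factor_base A i" by (simp add: js)
  assume "u \<in> factor_base A i" "v \<in> factor_base A i"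
  then show "u \<otimes>\<^bsub>factor_algebra A i\<^esub> v \<in> factor_base A i"
    using j by (auto simp: js)
qed

text \<open>
  The families behind \<^const>\<open>site_tensor\<close>; both products \<open>p\<^sub>j\<close> and \<open>p'\<^sub>j\<close> are covered by the choice
  of \<open>w\<close>, which takes units and idempotents as values (\<open>base_family\<close>).
\<close>

definition site_family where
  "site_family j u v w = (\<lambda>(k, s). if k = j then (case s of First \<Rightarrow> u | Second \<Rightarrow> v) else w k)"

lemma site_family_at [simp]:
  "site_family j u v w (j, First) = u" "site_family j u v w (j, Second) = v"
  by (simp_all add: site_family_def)

lemma site_family_off:
  "i \<noteq> (j, First) \<Longrightarrow> site_family j u v w i = site_family j u' v w i"
  "i \<noteq> (j, Second) \<Longrightarrow> site_family j u v w i = site_family j u v' w i"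
  by (cases i; cases "snd i"; simp add: site_family_def)+

definition base_family where
  "base_family w \<longleftrightarrow> (\<forall>k\<in>J. w k = one k \<or> w k = P k)"

lemma base_family_simps [simp]:
  "base_family (p_factors A)" "base_family (p'_factors A j)"
  by (auto simp: base_family_def p_factors_def p'_factors_def)

lemma base_family_mult [simp]:
  assumes "base_family v" "base_family w"
  shows "base_family (\<lambda>k. v k \<otimes>\<^bsub>extension (A k)\<^esub> w k)"
  unfolding base_family_def
proof
  fix k assume k: "k \<in> J"
  then have "v k = one k \<or> v k = P k" "w k = one k \<or> w k = P k"
    using assms by (simp_all add: base_family_def)
  then show "v k \<otimes>\<^bsub>extension (A k)\<^esub> w k = one k \<or> v k \<otimes>\<^bsub>extension (A k)\<^esub> w k = P k"
    using k by (elim disjE) simp_all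
qed

lemma base_family_closed: "base_family w \<Longrightarrow> k \<in> J \<Longrightarrow> w k \<in> carrier (extension (A k))"
  by (metis base_family_def extension_closed(1,2))

lemma admissible_site_family:
  assumes "u \<in> carrier (extension (A j))" "v \<in> carrier (extension (A j))" "base_family w"
  shows "admissible (site_family j u v w)"
proof -
  let ?S = "{i \<in> factor_set J. site_family j u v w i \<notin> factor_base A i}"
  have "?S \<subseteq> {(j, First), (j, Second)}"
  proof
    fix i assume i: "i \<in> ?S"
    obtain k s where "i = (k, s)" by (cases i)
    then show "i \<in> {(j, First), (j, Second)}"
      using i assms(3) by (cases s) (auto simp: site_family_def base_family_def split: if_splits)
  qed
  then have "finite ?S" by (rule finite_subset) simp
  moreover have "site_family j u v w i \<in> carrier (factor_algebra A i)" if "i \<in> factor_set J" for i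
    using that assms base_family_closed[OF assms(3)]
    by (cases i) (auto simp: site_family_def split: position.splits)
  ultimately show ?thesis by (simp add: admissible_def)
qed

lemma site_tensor_eq: "site_tensor J A j u v w = st (site_family j u v w)"
  by (simp add: site_tensor_def site_family_def)

lemma big_algebra_eq: "big_algebra J A = TA"
  by (simp add: big_algebra_def)

lemma site_tensor_closed [simp, intro]:
  assumes "u \<in> carrier (extension (A j))" "v \<in> carrier (extension (A j))" "base_family w"
  shows "site_tensor J A j u v w \<in> carrier TA"
  unfolding site_tensor_eq by (intro simple_tensor_closed admissible_site_family assms)

lemma site_tensor_mult:
  assumes "u \<in> carrier (extension (A j))" "v \<in> carrier (extension (A j))" "base_family w"
    and "u' \<in> carrier (extension (A j))" "v' \<in> carrier (extension (A j))" "base_family w'"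
  shows "site_tensor J A j u v w \<otimes>\<^bsub>TA\<^esub> site_tensor J A j u' v' w'
    = site_tensor J A j (u \<otimes>\<^bsub>extension (A j)\<^esub> u') (v \<otimes>\<^bsub>extension (A j)\<^esub> v')
        (\<lambda>k. w k \<otimes>\<^bsub>extension (A k)\<^esub> w' k)"
proof -
  have "site_family j u v w i \<otimes>\<^bsub>factor_algebra A i\<^esub> site_family j u' v' w' i
      = site_family j (u \<otimes>\<^bsub>extension (A j)\<^esub> u') (v \<otimes>\<^bsub>extension (A j)\<^esub> v')
          (\<lambda>k. w k \<otimes>\<^bsub>extension (A k)\<^esub> w' k) i" for i
    by (cases i) (simp add: site_family_def split: position.split)
  then show ?thesis
    using simple_tensor_mult[OF admissible_site_family[OF assms(1-3)]
        admissible_site_family[OF assms(4-6)]]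
    by (simp add: site_tensor_eq)
qed

lemma site_tensor_cong:
  assumes "\<And>k. k \<in> J \<Longrightarrow> k \<noteq> j \<Longrightarrow> w k = w' k"
  shows "site_tensor J A j u v w = site_tensor J A j u v w'"
  unfolding site_tensor_eq using assms by (intro simple_tensor_cong) (auto simp: site_family_def)

lemma p_factors_mult:
  assumes "k \<in> J"
  shows "p_factors A k \<otimes>\<^bsub>extension (A k)\<^esub> p_factors A k = p_factors A k"
    "p_factors A k \<otimes>\<^bsub>extension (A k)\<^esub> p'_factors A j k = p_factors A k"
    "p'_factors A j k \<otimes>\<^bsub>extension (A k)\<^esub> p_factors A k = p_factors A k"
    "p'_factors A j k \<otimes>\<^bsub>extension (A k)\<^esub> p'_factors A j k = p'_factors A j k"
  using assms by (auto simp: p_factors_def p'_factors_def)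

text \<open>
  The relations \<open>p p = p p' = p' p = p\<close> and \<open>p' p' = p'\<close>.
\<close>

lemma site_tensor_mult_p:
  assumes "u \<in> carrier (extension (A j))" "v \<in> carrier (extension (A j))"
    and "u' \<in> carrier (extension (A j))" "v' \<in> carrier (extension (A j))"
  defines "uu \<equiv> u \<otimes>\<^bsub>extension (A j)\<^esub> u'" and "vv \<equiv> v \<otimes>\<^bsub>extension (A j)\<^esub> v'"
  shows "site_tensor J A j u v (p_factors A) \<otimes>\<^bsub>TA\<^esub> site_tensor J A j u' v' (p_factors A)
      = site_tensor J A j uu vv (p_factors A)"
    and "site_tensor J A j u v (p_factors A) \<otimes>\<^bsub>TA\<^esub> site_tensor J A j u' v' (p'_factors A j)
      = site_tensor J A j uu vv (p_factors A)"
    and "site_tensor J A j u v (p'_factors A j) \<otimes>\<^bsub>TA\<^esub> site_tensor J A j u' v' (p_factors A)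
      = site_tensor J A j uu vv (p_factors A)"
    and "site_tensor J A j u v (p'_factors A j) \<otimes>\<^bsub>TA\<^esub> site_tensor J A j u' v' (p'_factors A j)
      = site_tensor J A j uu vv (p'_factors A j)"
  using assms(1-4) unfolding uu_def vv_def
  by (auto simp: site_tensor_mult p_factors_mult intro!: site_tensor_cong)

abbreviation first_part where
  "first_part j a \<equiv> site_tensor J A j (emb j a) (one j) (p_factors A)"
abbreviation second_part where
  "second_part j a \<equiv> site_tensor J A j (one j) (emb j a) (p'_factors A j)"
abbreviation correction where
  "correction j a \<equiv> site_tensor J A j (one j) (emb j a) (p_factors A)"

lemma replica_eq:
  "replica J A j a = first_part j a \<oplus>\<^bsub>TA\<^esub> (second_part j a \<ominus>\<^bsub>TA\<^esub> correction j a)"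
  by (simp add: replica_def big_algebra_eq)

lemma replica_closed [simp, intro]:
  assumes "j \<in> J" "a \<in> carrier (A j)"
  shows "replica J A j a \<in> carrier TA"
  unfolding replica_eq using assms by auto

text \<open>
  \<open>p\<close> and \<open>p' - p\<close> are orthogonal idempotents, so the two halves of a replica multiply separately.
\<close>

lemma replica_mult:
  assumes j: "j \<in> J" and ab: "a \<in> carrier (A j)" "b \<in> carrier (A j)"
  shows "replica J A j a \<otimes>\<^bsub>TA\<^esub> replica J A j b = replica J A j (a \<otimes>\<^bsub>A j\<^esub> b)"
proof -
  interpret B: idempotent_extension "A j" by (rule idempotent_extension[OF j])
  show ?thesis
    unfolding replica_eq using j ab
    by (subst TA.orthogonal_sum_mult) (auto simp: site_tensor_mult_p B.ext_emb_mult)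
qed

lemma site_family_update:
  "site_family j z x w = (site_family j x x w)((j, First) := z)"
  "site_family j x z w = (site_family j x x w)((j, Second) := z)"
  by (auto simp: site_family_def fun_eq_iff split: position.splits)

lemma site_tensor_add:
  assumes j: "j \<in> J" and uv: "u \<in> carrier (extension (A j))" "v \<in> carrier (extension (A j))"
    and w: "base_family w" and x: "x \<in> carrier (extension (A j))"
  shows "site_tensor J A j (u \<oplus>\<^bsub>extension (A j)\<^esub> v) x w
      = site_tensor J A j u x w \<oplus>\<^bsub>TA\<^esub> site_tensor J A j v x w"
    and "site_tensor J A j x (u \<oplus>\<^bsub>extension (A j)\<^esub> v) w
      = site_tensor J A j x u w \<oplus>\<^bsub>TA\<^esub> site_tensor J A j x v w"
  using simple_tensor_add[OF admissible_site_family[OF x x w], of "(j, First)" u v]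
    simple_tensor_add[OF admissible_site_family[OF x x w], of "(j, Second)" u v] j uv
  unfolding site_tensor_eq
  by (simp_all add: site_family_update[symmetric])

lemma site_tensor_scale:
  assumes j: "j \<in> J" and u: "u \<in> carrier (extension (A j))"
    and w: "base_family w" and x: "x \<in> carrier (extension (A j))"
  shows "site_tensor J A j (c \<odot>\<^bsub>extension (A j)\<^esub> u) x w = c \<odot>\<^bsub>TA\<^esub> site_tensor J A j u x w"
    and "site_tensor J A j x (c \<odot>\<^bsub>extension (A j)\<^esub> u) w = c \<odot>\<^bsub>TA\<^esub> site_tensor J A j x u w"
  using simple_tensor_scale[OF admissible_site_family[OF x x w], of "(j, First)" u c]
    simple_tensor_scale[OF admissible_site_family[OF x x w], of "(j, Second)" u c] j u
  unfolding site_tensor_eq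
  by (simp_all add: site_family_update[symmetric])

lemma replica_add:
  assumes j: "j \<in> J" and ab: "a \<in> carrier (A j)" "b \<in> carrier (A j)"
  shows "replica J A j a \<oplus>\<^bsub>TA\<^esub> replica J A j b = replica J A j (a \<oplus>\<^bsub>A j\<^esub> b)"
proof -
  interpret B: idempotent_extension "A j" by (rule idempotent_extension[OF j])
  have "(x \<oplus>\<^bsub>TA\<^esub> (y \<ominus>\<^bsub>TA\<^esub> z)) \<oplus>\<^bsub>TA\<^esub> (x' \<oplus>\<^bsub>TA\<^esub> (y' \<ominus>\<^bsub>TA\<^esub> z'))
      = (x \<oplus>\<^bsub>TA\<^esub> x') \<oplus>\<^bsub>TA\<^esub> ((y \<oplus>\<^bsub>TA\<^esub> y') \<ominus>\<^bsub>TA\<^esub> (z \<oplus>\<^bsub>TA\<^esub> z'))"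
    if "x \<in> carrier TA" "y \<in> carrier TA" "z \<in> carrier TA"
      "x' \<in> carrier TA" "y' \<in> carrier TA" "z' \<in> carrier TA" for x y z x' y' z'
    using that by (simp add: a_minus_def TA.minus_add TA.a_ac)
  then show ?thesis
    unfolding replica_eq using j ab by (simp add: B.ext_emb_add site_tensor_add)
qed

lemma replica_scale:
  assumes j: "j \<in> J" and a: "a \<in> carrier (A j)"
  shows "c \<odot>\<^bsub>TA\<^esub> replica J A j a = replica J A j (c \<odot>\<^bsub>A j\<^esub> a)"
proof -
  interpret B: idempotent_extension "A j" by (rule idempotent_extension[OF j])
  show ?thesis
    unfolding replica_eq using j a
    by (simp add: B.ext_emb_scale site_tensor_scale TA.diff_eq_scale TA.scale_distrib_right
        TA.scale_scale mult.commute)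
qed

lemma replica_subalgebra:
  assumes j: "j \<in> J"
  shows "complex_subalgebra {replica J A j a | a. a \<in> carrier (A j)} TA"
proof -
  interpret B: ring_over_complex "A j" by (rule algebra[OF j])
  have "0 \<odot>\<^bsub>TA\<^esub> replica J A j \<one>\<^bsub>A j\<^esub> = \<zero>\<^bsub>TA\<^esub>"
    using j by (intro TA.scale_zero) auto
  then have zero: "\<zero>\<^bsub>TA\<^esub> = replica J A j (0 \<odot>\<^bsub>A j\<^esub> \<one>\<^bsub>A j\<^esub>)"
    using j by (simp add: replica_scale)
  show ?thesis
    unfolding complex_subalgebra_def
  proof (intro conjI ballI allI)
    let ?S = "{replica J A j a | a. a \<in> carrier (A j)}"
    show "\<zero>\<^bsub>TA\<^esub> \<in> ?S" using zero by blast
    show "?S \<subseteq> carrier TA" using j by blast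
    fix x y c assume x: "x \<in> ?S"
    then obtain a where a: "x = replica J A j a" "a \<in> carrier (A j)" by blast
    then have "c \<odot>\<^bsub>TA\<^esub> x = replica J A j (c \<odot>\<^bsub>A j\<^esub> a)" using j by (simp add: replica_scale)
    then show "c \<odot>\<^bsub>TA\<^esub> x \<in> ?S" using a by blast
    assume "y \<in> ?S"
    then obtain b where b: "y = replica J A j b" "b \<in> carrier (A j)" by blast
    have "x \<oplus>\<^bsub>TA\<^esub> y = replica J A j (a \<oplus>\<^bsub>A j\<^esub> b)" "x \<otimes>\<^bsub>TA\<^esub> y = replica J A j (a \<otimes>\<^bsub>A j\<^esub> b)"
      using a b j by (simp_all add: replica_add replica_mult)
    then show "x \<oplus>\<^bsub>TA\<^esub> y \<in> ?S" "x \<otimes>\<^bsub>TA\<^esub> y \<in> ?S" using a b by blast+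
  qed
qed

text \<open>
  Replicas of one index are closed under all operations, so generating a subalgebra adds nothing.
\<close>

lemma generated_subalgebra_replicas:
  assumes "j \<in> J"
  shows "generated_subalgebra TA {replica J A j a | a. a \<in> carrier (A j)}
    = {replica J A j a | a. a \<in> carrier (A j)}"
  unfolding generated_subalgebra_def using replica_subalgebra[OF assms] by blast

text \<open>
  The simple tensor with the unit at all indices below \<open>j\<close> and with \<open>P\<close> from \<open>j\<close> on.
\<close>

definition cut where "cut j = site_tensor J A j (P j) (P j) (p'_factors A j)"

lemma cut_closed [simp, intro]: "j \<in> J \<Longrightarrow> cut j \<in> carrier TA"
  unfolding cut_def by auto

text \<open>
  The same tensor seen from a smaller index, where both of its entries are units.
\<close>

lemma cut_eq_below:
  assumes "j < k"
  shows "cut k = site_tensor J A j (one j) (one j) (p'_factors A k)"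
  unfolding cut_def site_tensor_eq
proof (rule simple_tensor_cong)
  fix i :: "'j \<times> position"
  obtain l s where i: "i = (l, s)" by (cases i)
  show "site_family k (P k) (P k) (p'_factors A k) i
      = site_family j (one j) (one j) (p'_factors A k) i"
    unfolding i using assms assms[THEN less_imp_neq]
    by (cases s) (simp_all add: site_family_def p'_factors_def)
qed

text \<open>
  All three terms of a replica of index \<open>j\<close> carry \<open>P\<close> at every index above \<open>j\<close>, in particular from
  \<open>k\<close> on, where \<open>P\<close> absorbs \<open>P\<close>; below \<open>k\<close> the cut consists of units.
\<close>

lemma replica_cut:
  assumes jk: "j \<in> J" "k \<in> J" "j < k" and a: "a \<in> carrier (A j)"
  shows "replica J A j a \<otimes>\<^bsub>TA\<^esub> cut k = replica J A j a"
    and "cut k \<otimes>\<^bsub>TA\<^esub> replica J A j a = replica J A j a"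
proof -
  have absorb: "site_tensor J A j u v w \<otimes>\<^bsub>TA\<^esub> cut k = site_tensor J A j u v w"
    "cut k \<otimes>\<^bsub>TA\<^esub> site_tensor J A j u v w = site_tensor J A j u v w"
    if uv: "u \<in> carrier (extension (A j))" "v \<in> carrier (extension (A j))"
      and w: "w = p_factors A \<or> w = p'_factors A j" for u v w
  proof -
    have fam: "base_family w" using w by auto
    have "w l \<otimes>\<^bsub>extension (A l)\<^esub> p'_factors A k l = w l"
      "p'_factors A k l \<otimes>\<^bsub>extension (A l)\<^esub> w l = w l" if "l \<in> J" for l
      using that w jk(3) less_trans[of l j k]
      by (elim disjE; simp add: p_factors_def p'_factors_def)+
    then show "site_tensor J A j u v w \<otimes>\<^bsub>TA\<^esub> cut k = site_tensor J A j u v w"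
      "cut k \<otimes>\<^bsub>TA\<^esub> site_tensor J A j u v w = site_tensor J A j u v w"
      unfolding cut_eq_below[OF jk(3)] using uv jk fam
      by (auto simp: site_tensor_mult intro!: site_tensor_cong)
  qed
  show "replica J A j a \<otimes>\<^bsub>TA\<^esub> cut k = replica J A j a"
    and "cut k \<otimes>\<^bsub>TA\<^esub> replica J A j a = replica J A j a"
    unfolding replica_eq using jk a
    by (simp_all add: TA.l_distr TA.r_distr TA.diff_eq_scale TA.scale_mult_left
        TA.scale_mult_right absorb)
qed

text \<open>
  Compressing by the cut turns \<open>a\<close> into \<open>P a P\<close> and the unit next to it into \<open>P\<close>, and changes
  nothing at the other indices: there \<open>p\<close> and \<open>p'\<close> absorb the entries of the cut.
\<close>

lemma cut_replica_cut:
  assumes j: "j \<in> J" and a: "a \<in> carrier (A j)"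
  defines "b \<equiv> P j \<otimes>\<^bsub>extension (A j)\<^esub> emb j a \<otimes>\<^bsub>extension (A j)\<^esub> P j"
  shows "cut j \<otimes>\<^bsub>TA\<^esub> replica J A j a \<otimes>\<^bsub>TA\<^esub> cut j
    = site_tensor J A j b (P j) (p_factors A) \<oplus>\<^bsub>TA\<^esub>
        (site_tensor J A j (P j) b (p'_factors A j) \<ominus>\<^bsub>TA\<^esub> site_tensor J A j (P j) b (p_factors A))"
  unfolding replica_eq cut_def b_def using j a
  by (simp add: TA.l_distr TA.r_distr TA.diff_eq_scale TA.scale_mult_left
      TA.scale_mult_right site_tensor_mult_p)

end

section \<open>Product states on replicas\<close>

text \<open>
  The product state of \<open>\<chi>\<close> in the first positions and \<open>\<omega>\<close> in the second ones. The theorem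
  uses the two instances \<open>\<chi> = \<phi>, \<omega> = \<psi>\<close> and \<open>\<chi> = \<omega> = \<psi>\<close>.
\<close>

locale algebra_family_with_states = algebra_family J A
  for J :: "'j::linorder set" and A :: "'j \<Rightarrow> (complex, 'a) module" +
  fixes \<chi> \<omega> :: "'j \<Rightarrow> 'a \<Rightarrow> complex"
  assumes states: "j \<in> J \<Longrightarrow> state (A j) (\<chi> j)" "j \<in> J \<Longrightarrow> state (A j) (\<omega> j)"
begin

definition state_at :: "'j \<times> position \<Rightarrow> 'a \<Rightarrow> complex" where
  "state_at = (\<lambda>(j, s). case s of First \<Rightarrow> \<chi> j | Second \<Rightarrow> \<omega> j)"

definition factor_state :: "'j \<times> position \<Rightarrow> ('a letter list \<Rightarrow> complex) set \<Rightarrow> complex" where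
  "factor_state = (\<lambda>(j, s). case s of First \<Rightarrow> extended_state (A j) (\<chi> j)
                                   | Second \<Rightarrow> extended_state (A j) (\<omega> j))"

lemma factor_state_eq: "factor_state (j, s) = extended_state (A j) (state_at (j, s))"
  by (simp add: factor_state_def state_at_def split: position.split)

lemma state_at: "j \<in> J \<Longrightarrow> state (A j) (state_at (j, s))"
  by (simp add: state_at_def states split: position.split)

lemma factor_state_values:
  assumes j: "j \<in> J"
  shows "linear_functional (extension (A j)) (factor_state (j, s))"
    and "factor_state (j, s) (one j) = 1" "factor_state (j, s) (P j) = 1"
    and "a \<in> carrier (A j) \<Longrightarrow> factor_state (j, s) (emb j a) = state_at (j, s) a"
    and "x \<in> carrier (extension (A j)) \<Longrightarrow> y \<in> carrier (extension (A j)) \<Longrightarrow>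
      factor_state (j, s) (x \<otimes>\<^bsub>extension (A j)\<^esub> P j \<otimes>\<^bsub>extension (A j)\<^esub> y)
        = factor_state (j, s) x * factor_state (j, s) y"
proof -
  interpret idempotent_extension "A j" by (rule idempotent_extension[OF j])
  note st = state_at[OF j]
  show "linear_functional (extension (A j)) (factor_state (j, s))"
    and "factor_state (j, s) (one j) = 1" "factor_state (j, s) (P j) = 1"
    and "a \<in> carrier (A j) \<Longrightarrow> factor_state (j, s) (emb j a) = state_at (j, s) a"
    and "x \<in> carrier (extension (A j)) \<Longrightarrow> y \<in> carrier (extension (A j)) \<Longrightarrow>
      factor_state (j, s) (x \<otimes>\<^bsub>extension (A j)\<^esub> P j \<otimes>\<^bsub>extension (A j)\<^esub> y)
        = factor_state (j, s) x * factor_state (j, s) y"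
    by (simp_all add: factor_state_eq linear_extended_state[OF st] extended_state_one[OF st]
        extended_state_P[OF st] extended_state_emb[OF st] extended_state_P_between[OF st])
qed

lemma factor_state_mult_P:
  assumes j: "j \<in> J" and x: "x \<in> carrier (extension (A j))"
  shows "factor_state (j, s) (P j \<otimes>\<^bsub>extension (A j)\<^esub> x) = factor_state (j, s) x"
    and "factor_state (j, s) (x \<otimes>\<^bsub>extension (A j)\<^esub> P j) = factor_state (j, s) x"
  using factor_state_values(5)[OF j extension_closed(1)[OF j] x, of s]
    factor_state_values(5)[OF j x extension_closed(1)[OF j], of s] j x
  by (simp_all add: factor_state_values(2))

sublocale tensor_functionals "factor_set J" "factor_algebra A" "factor_base A" factor_state
proof (intro tensor_functionals.intro tensor_functionals_axioms.intro tensor_factors_axioms)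
  fix i u assume i: "i \<in> factor_set J"
  obtain j s where js: "i = (j, s)" by (cases i)
  with i have j: "j \<in> J" by simp
  show "linear_functional (factor_algebra A i) (factor_state i)"
    using factor_state_values(1)[OF j] by (simp add: js)
  assume "u \<in> factor_base A i"
  then show "factor_state i u = 1"
    using factor_state_values(2,3)[OF j] by (auto simp: js)
qed

lemma big_state_eq: "big_state J A \<chi> \<omega> = pst"
  by (simp add: big_state_def factor_state_def)

lemma simple_tensor_sandwich:
  assumes "admissible x" "admissible z" "admissible y"
  shows "pst (st x \<otimes>\<^bsub>TA\<^esub> st z \<otimes>\<^bsub>TA\<^esub> st y) = product_value (factor_set J) factor_state
      (\<lambda>i. x i \<otimes>\<^bsub>factor_algebra A i\<^esub> z i \<otimes>\<^bsub>factor_algebra A i\<^esub> y i)"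
  using assms by (simp add: simple_tensor_mult product_state_simple_tensor admissible_mult)

lemma linear_sandwich:
  assumes "z \<in> carrier TA" "x \<in> carrier TA"
  shows "linear_functional TA (\<lambda>y. pst (y \<otimes>\<^bsub>TA\<^esub> z \<otimes>\<^bsub>TA\<^esub> x))"
    "linear_functional TA (\<lambda>y. pst (x \<otimes>\<^bsub>TA\<^esub> z \<otimes>\<^bsub>TA\<^esub> y))"
    "linear_functional TA (\<lambda>y. c * pst (y \<otimes>\<^bsub>TA\<^esub> z \<otimes>\<^bsub>TA\<^esub> x))"
    "linear_functional TA (\<lambda>y. c * pst (x \<otimes>\<^bsub>TA\<^esub> z \<otimes>\<^bsub>TA\<^esub> y))"
proof -
  note lin = TA.linear_functional_sandwich[OF linear_product_state assms]
  show "linear_functional TA (\<lambda>y. pst (y \<otimes>\<^bsub>TA\<^esub> z \<otimes>\<^bsub>TA\<^esub> x))"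
    "linear_functional TA (\<lambda>y. pst (x \<otimes>\<^bsub>TA\<^esub> z \<otimes>\<^bsub>TA\<^esub> y))" by (rule lin)+
  show "linear_functional TA (\<lambda>y. c * pst (y \<otimes>\<^bsub>TA\<^esub> z \<otimes>\<^bsub>TA\<^esub> x))"
    "linear_functional TA (\<lambda>y. c * pst (x \<otimes>\<^bsub>TA\<^esub> z \<otimes>\<^bsub>TA\<^esub> y))"
    using lin unfolding linear_functional_def by (auto simp: algebra_simps)
qed

text \<open>
  In every factor the state splits at \<open>P\<close>, hence so does the product state at a tensor with \<open>P\<close> in
  all factors.
\<close>

lemma state_P_everywhere:
  assumes z: "\<And>k s. k \<in> J \<Longrightarrow> z (k, s) = P k" and x: "x \<in> carrier TA" and y: "y \<in> carrier TA"
  shows "pst (x \<otimes>\<^bsub>TA\<^esub> st z \<otimes>\<^bsub>TA\<^esub> y) = pst x * pst y"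
proof -
  have base: "z i \<in> factor_base A i" if "i \<in> factor_set J" for i
    using that z by (cases i) simp
  then have adm: "admissible z" by (rule admissible_base)
  have agree: "pst (st u \<otimes>\<^bsub>TA\<^esub> st z \<otimes>\<^bsub>TA\<^esub> st v) = pst (st u) * pst (st v)"
    if u: "admissible u" and v: "admissible v" for u v
    unfolding simple_tensor_sandwich[OF u adm v] product_state_simple_tensor[OF u]
      product_state_simple_tensor[OF v]
  proof (rule product_value_mult[OF u v])
    fix i assume i: "i \<in> factor_set J"
    obtain k s where ks: "i = (k, s)" by (cases i)
    then show "factor_state i (u i \<otimes>\<^bsub>factor_algebra A i\<^esub> z i \<otimes>\<^bsub>factor_algebra A i\<^esub> v i)
        = factor_state i (u i) * factor_state i (v i)"
      using i z factor_state_values(5)[of k "u i" "v i" s] admissible_closed[OF u i]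
        admissible_closed[OF v i] by simp
  qed
  have lin: "linear_functional TA (\<lambda>x. pst x * c)" "linear_functional TA (\<lambda>x. c * pst x)" for c
    using linear_product_state unfolding linear_functional_def by (simp_all add: algebra_simps)
  show ?thesis
    by (rule tensor_bilinear_eqI[of "\<lambda>x y. pst (x \<otimes>\<^bsub>TA\<^esub> st z \<otimes>\<^bsub>TA\<^esub> y)" "\<lambda>x y. pst x * pst y"])
      (assumption | rule linear_sandwich simple_tensor_closed adm lin agree x y)+
qed

text \<open>
  Under the state of a factor, \<open>x (P a P) y\<close> has the value of \<open>a\<close> times the value of \<open>x P y\<close>.
\<close>

lemma state_compression:
  assumes z: "admissible z" and e: "admissible e" and k: "k \<in> J" and a: "a \<in> carrier (A k)"
    and e_at: "e (k, s) = P k"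
    and z_at: "z (k, s) = P k \<otimes>\<^bsub>extension (A k)\<^esub> emb k a \<otimes>\<^bsub>extension (A k)\<^esub> P k"
    and off: "\<And>i. i \<in> factor_set J \<Longrightarrow> i \<noteq> (k, s) \<Longrightarrow> z i = e i"
    and x: "x \<in> carrier TA" and y: "y \<in> carrier TA"
  shows "pst (x \<otimes>\<^bsub>TA\<^esub> st z \<otimes>\<^bsub>TA\<^esub> y) = state_at (k, s) a * pst (x \<otimes>\<^bsub>TA\<^esub> st e \<otimes>\<^bsub>TA\<^esub> y)"
proof -
  interpret B: ring_over_complex "extension (A k)" by (rule extension_algebra[OF k])
  note vals = factor_state_values[OF k]
  have agree: "pst (st u \<otimes>\<^bsub>TA\<^esub> st z \<otimes>\<^bsub>TA\<^esub> st v) = state_at (k, s) a * pst (st u \<otimes>\<^bsub>TA\<^esub> st e \<otimes>\<^bsub>TA\<^esub> st v)"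
    if u: "admissible u" and v: "admissible v" for u v
    unfolding simple_tensor_sandwich[OF u z v] simple_tensor_sandwich[OF u e v]
  proof (rule product_value_rescale[of _ _ "(k, s)"])
    have uk: "u (k, s) \<in> carrier (extension (A k))" and vk: "v (k, s) \<in> carrier (extension (A k))"
      using admissible_closed[OF u, of "(k, s)"] admissible_closed[OF v, of "(k, s)"] k by simp_all
    have "u (k, s) \<otimes>\<^bsub>extension (A k)\<^esub> z (k, s) \<otimes>\<^bsub>extension (A k)\<^esub> v (k, s)
        = u (k, s) \<otimes>\<^bsub>extension (A k)\<^esub> P k \<otimes>\<^bsub>extension (A k)\<^esub>
            (emb k a \<otimes>\<^bsub>extension (A k)\<^esub> P k \<otimes>\<^bsub>extension (A k)\<^esub> v (k, s))"
      using uk vk k a by (simp add: z_at B.m_assoc)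
    then show "factor_state (k, s) (u (k, s) \<otimes>\<^bsub>factor_algebra A (k, s)\<^esub> z (k, s)
          \<otimes>\<^bsub>factor_algebra A (k, s)\<^esub> v (k, s))
        = state_at (k, s) a * factor_state (k, s) (u (k, s) \<otimes>\<^bsub>factor_algebra A (k, s)\<^esub> e (k, s)
          \<otimes>\<^bsub>factor_algebra A (k, s)\<^esub> v (k, s))"
      using uk vk k a by (simp add: e_at vals(4,5))
    show "(k, s) \<in> factor_set J" using k by simp
    show "admissible (\<lambda>i. u i \<otimes>\<^bsub>factor_algebra A i\<^esub> z i \<otimes>\<^bsub>factor_algebra A i\<^esub> v i)"
      "admissible (\<lambda>i. u i \<otimes>\<^bsub>factor_algebra A i\<^esub> e i \<otimes>\<^bsub>factor_algebra A i\<^esub> v i)"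
      by (intro admissible_mult u v z e)+
    fix i assume "i \<in> factor_set J" "i \<noteq> (k, s)"
    then have "z i = e i" by (rule off)
    then show "factor_state i (u i \<otimes>\<^bsub>factor_algebra A i\<^esub> z i \<otimes>\<^bsub>factor_algebra A i\<^esub> v i)
        = factor_state i (u i \<otimes>\<^bsub>factor_algebra A i\<^esub> e i \<otimes>\<^bsub>factor_algebra A i\<^esub> v i)" by simp
  qed
  show ?thesis
    by (rule tensor_bilinear_eqI[of "\<lambda>x y. pst (x \<otimes>\<^bsub>TA\<^esub> st z \<otimes>\<^bsub>TA\<^esub> y)"
          "\<lambda>x y. state_at (k, s) a * pst (x \<otimes>\<^bsub>TA\<^esub> st e \<otimes>\<^bsub>TA\<^esub> y)"])
      (assumption | rule linear_sandwich simple_tensor_closed z e agree x y)+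
qed

text \<open>
  At either end of a product the entries 1 and \<open>P\<close> of the cut do not change the values of the
  factor states, so the cut can be inserted there. This handles a peak without a neighbour on one
  side.
\<close>

lemma state_cut:
  assumes k: "k \<in> J" and x: "x \<in> carrier TA"
  shows "pst (cut k \<otimes>\<^bsub>TA\<^esub> x) = pst x" "pst (x \<otimes>\<^bsub>TA\<^esub> cut k) = pst x"
proof -
  let ?e = "site_family k (P k) (P k) (p'_factors A k)"
  have e: "admissible ?e" using k by (intro admissible_site_family) auto
  have e_at: "?e (l, s) = one l \<or> ?e (l, s) = P l" for l s
    by (cases s) (simp_all add: site_family_def p'_factors_def)
  have absorb: "factor_state i (?e i \<otimes>\<^bsub>factor_algebra A i\<^esub> u i) = factor_state i (u i)"
    "factor_state i (u i \<otimes>\<^bsub>factor_algebra A i\<^esub> ?e i) = factor_state i (u i)"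
    if u: "admissible u" and i: "i \<in> factor_set J" for u i
  proof -
    obtain l s where ls: "i = (l, s)" by (cases i)
    then have l: "l \<in> J" "u (l, s) \<in> carrier (extension (A l))"
      using i admissible_closed[OF u i] by simp_all
    show "factor_state i (?e i \<otimes>\<^bsub>factor_algebra A i\<^esub> u i) = factor_state i (u i)"
      "factor_state i (u i \<otimes>\<^bsub>factor_algebra A i\<^esub> ?e i) = factor_state i (u i)"
      using e_at[of l s] l unfolding ls by (elim disjE; simp add: factor_state_mult_P)+
  qed
  have same: "product_value (factor_set J) factor_state u = product_value (factor_set J) factor_state v"
    if "\<And>i. i \<in> factor_set J \<Longrightarrow> factor_state i (u i) = factor_state i (v i)" for u v
    unfolding product_value_def by (rule prod.cong) (use that in auto)
  have left: "pst (cut k \<otimes>\<^bsub>TA\<^esub> st u) = pst (st u)" and right: "pst (st u \<otimes>\<^bsub>TA\<^esub> cut k) = pst (st u)"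
    if u: "admissible u" for u
    unfolding cut_def site_tensor_eq simple_tensor_mult[OF e u] simple_tensor_mult[OF u e]
      product_state_simple_tensor[OF admissible_mult[OF e u]]
      product_state_simple_tensor[OF admissible_mult[OF u e]] product_state_simple_tensor[OF u]
    by (rule same, rule absorb[OF u], assumption)+
  have lin: "linear_functional TA (\<lambda>x. pst (cut k \<otimes>\<^bsub>TA\<^esub> x))"
    "linear_functional TA (\<lambda>x. pst (x \<otimes>\<^bsub>TA\<^esub> cut k))"
    using linear_product_state k unfolding linear_functional_def
    by (auto simp: TA.l_distr TA.r_distr TA.scale_mult_left TA.scale_mult_right)
  show "pst (cut k \<otimes>\<^bsub>TA\<^esub> x) = pst x"
    by (rule tensor_functional_eqI[OF lin(1) linear_product_state left x])
  show "pst (x \<otimes>\<^bsub>TA\<^esub> cut k) = pst x"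
    by (rule tensor_functional_eqI[OF lin(2) linear_product_state right x])
qed

text \<open>
  Of the three terms of the compressed replica, the first one yields \<open>\<chi> a\<close> times the tensor with
  \<open>P\<close> everywhere, the second one \<open>\<omega> a\<close> times the cut, and the third one, which is subtracted,
  \<open>\<omega> a\<close> times the tensor with \<open>P\<close> everywhere. The state splits at the tensor with \<open>P\<close> everywhere.
\<close>

lemma state_peak:
  assumes k: "k \<in> J" and a: "a \<in> carrier (A k)" and x: "x \<in> carrier TA" and y: "y \<in> carrier TA"
  shows "pst (x \<otimes>\<^bsub>TA\<^esub> (cut k \<otimes>\<^bsub>TA\<^esub> replica J A k a \<otimes>\<^bsub>TA\<^esub> cut k) \<otimes>\<^bsub>TA\<^esub> y)
    = (\<chi> k a - \<omega> k a) * pst x * pst y + \<omega> k a * pst (x \<otimes>\<^bsub>TA\<^esub> cut k \<otimes>\<^bsub>TA\<^esub> y)"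
proof -
  define b where "b = P k \<otimes>\<^bsub>extension (A k)\<^esub> emb k a \<otimes>\<^bsub>extension (A k)\<^esub> P k"
  let ?all = "site_family k (P k) (P k) (p_factors A)"
  let ?X = "site_tensor J A k b (P k) (p_factors A)"
  let ?Y = "site_tensor J A k (P k) b (p'_factors A k)"
  let ?Z = "site_tensor J A k (P k) b (p_factors A)"
  have b: "b \<in> carrier (extension (A k))" using k a by (simp add: b_def)
  note adm = admissible_site_family
  have all: "pst (x \<otimes>\<^bsub>TA\<^esub> st ?all \<otimes>\<^bsub>TA\<^esub> y) = pst x * pst y"
    using x y by (intro state_P_everywhere)
      (auto simp: site_family_def p_factors_def split: position.split)
  have "pst (x \<otimes>\<^bsub>TA\<^esub> ?X \<otimes>\<^bsub>TA\<^esub> y) = state_at (k, First) a * pst (x \<otimes>\<^bsub>TA\<^esub> st ?all \<otimes>\<^bsub>TA\<^esub> y)"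
    unfolding site_tensor_eq using k a b x y
    by (intro state_compression adm site_family_off(1)) (simp_all add: b_def)
  moreover have "pst (x \<otimes>\<^bsub>TA\<^esub> ?Y \<otimes>\<^bsub>TA\<^esub> y) = state_at (k, Second) a * pst (x \<otimes>\<^bsub>TA\<^esub> cut k \<otimes>\<^bsub>TA\<^esub> y)"
    unfolding site_tensor_eq cut_def using k a b x y
    by (intro state_compression adm site_family_off(2)) (simp_all add: b_def)
  moreover have "pst (x \<otimes>\<^bsub>TA\<^esub> ?Z \<otimes>\<^bsub>TA\<^esub> y) = state_at (k, Second) a * pst (x \<otimes>\<^bsub>TA\<^esub> st ?all \<otimes>\<^bsub>TA\<^esub> y)"
    unfolding site_tensor_eq using k a b x y
    by (intro state_compression adm site_family_off(2)) (simp_all add: b_def)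
  moreover have "pst (x \<otimes>\<^bsub>TA\<^esub> (?X \<oplus>\<^bsub>TA\<^esub> (?Y \<ominus>\<^bsub>TA\<^esub> ?Z)) \<otimes>\<^bsub>TA\<^esub> y)
      = pst (x \<otimes>\<^bsub>TA\<^esub> ?X \<otimes>\<^bsub>TA\<^esub> y) + (pst (x \<otimes>\<^bsub>TA\<^esub> ?Y \<otimes>\<^bsub>TA\<^esub> y) - pst (x \<otimes>\<^bsub>TA\<^esub> ?Z \<otimes>\<^bsub>TA\<^esub> y))"
    using k b x y
    by (simp add: TA.l_distr TA.r_distr TA.diff_eq_scale TA.scale_mult_left TA.scale_mult_right
        linear_functionalD[OF linear_product_state])
  ultimately show ?thesis
    unfolding cut_replica_cut[OF k a] b_def[symmetric]
    by (simp add: all state_at_def algebra_simps)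
qed

text \<open>
  The peak formula with the unit on both sides.
\<close>

lemma state_replica:
  assumes k: "k \<in> J" and a: "a \<in> carrier (A k)"
  shows "pst (replica J A k a) = \<chi> k a"
proof -
  have one: "pst \<one>\<^bsub>TA\<^esub> = 1" using state_product_state by (simp add: state_def)
  have "pst (cut k) = 1" using state_cut(1)[OF k TA.one_closed] k one by simp
  moreover have "pst (cut k \<otimes>\<^bsub>TA\<^esub> replica J A k a \<otimes>\<^bsub>TA\<^esub> cut k) = pst (replica J A k a)"
    using k a by (simp add: state_cut)
  ultimately show ?thesis
    using state_peak[OF k a TA.one_closed TA.one_closed] k a one by simp
qed

text \<open>
  The cuts around the replica are created by the neighbours, or by \<open>state_cut\<close> where there is none;
  afterwards the cut that remains between \<open>x\<close> and \<open>y\<close> is given back.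
\<close>

lemma state_peak_product:
  assumes k: "k \<in> J" and a: "a \<in> carrier (A k)" and x: "x \<in> carrier TA" and y: "y \<in> carrier TA"
    and x_cut: "x = \<one>\<^bsub>TA\<^esub> \<or> x \<otimes>\<^bsub>TA\<^esub> cut k = x" and y_cut: "y = \<one>\<^bsub>TA\<^esub> \<or> cut k \<otimes>\<^bsub>TA\<^esub> y = y"
  shows "pst (x \<otimes>\<^bsub>TA\<^esub> (replica J A k a \<otimes>\<^bsub>TA\<^esub> y))
    = (\<chi> k a - \<omega> k a) * pst x * pst y + \<omega> k a * pst (x \<otimes>\<^bsub>TA\<^esub> y)"
proof -
  let ?R = "replica J A k a"
  have R: "?R \<in> carrier TA" and c: "cut k \<in> carrier TA" using k a by auto
  have left: "pst (x \<otimes>\<^bsub>TA\<^esub> (cut k \<otimes>\<^bsub>TA\<^esub> z)) = pst (x \<otimes>\<^bsub>TA\<^esub> z)" if z: "z \<in> carrier TA" for z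
    using x_cut
  proof
    assume "x = \<one>\<^bsub>TA\<^esub>"
    then show ?thesis using z c k by (simp add: state_cut)
  next
    assume "x \<otimes>\<^bsub>TA\<^esub> cut k = x"
    then show ?thesis using x z c by (metis TA.m_assoc)
  qed
  have right: "pst (z \<otimes>\<^bsub>TA\<^esub> (cut k \<otimes>\<^bsub>TA\<^esub> y)) = pst (z \<otimes>\<^bsub>TA\<^esub> y)" if z: "z \<in> carrier TA" for z
    using y_cut
  proof
    assume "y = \<one>\<^bsub>TA\<^esub>"
    then show ?thesis using z c k by (simp add: state_cut)
  qed simp
  have "pst (x \<otimes>\<^bsub>TA\<^esub> (cut k \<otimes>\<^bsub>TA\<^esub> ?R \<otimes>\<^bsub>TA\<^esub> cut k) \<otimes>\<^bsub>TA\<^esub> y)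
      = pst (x \<otimes>\<^bsub>TA\<^esub> (cut k \<otimes>\<^bsub>TA\<^esub> (?R \<otimes>\<^bsub>TA\<^esub> (cut k \<otimes>\<^bsub>TA\<^esub> y))))"
    using x y R c by (simp add: TA.m_assoc)
  also have "\<dots> = pst (x \<otimes>\<^bsub>TA\<^esub> (?R \<otimes>\<^bsub>TA\<^esub> (cut k \<otimes>\<^bsub>TA\<^esub> y)))"
    using y R c by (intro left) auto
  also have "\<dots> = pst ((x \<otimes>\<^bsub>TA\<^esub> ?R) \<otimes>\<^bsub>TA\<^esub> (cut k \<otimes>\<^bsub>TA\<^esub> y))"
    using x y R c by (simp add: TA.m_assoc)
  also have "\<dots> = pst ((x \<otimes>\<^bsub>TA\<^esub> ?R) \<otimes>\<^bsub>TA\<^esub> y)"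
    using x R by (intro right) auto
  also have "\<dots> = pst (x \<otimes>\<^bsub>TA\<^esub> (?R \<otimes>\<^bsub>TA\<^esub> y))"
    using x y R by (simp add: TA.m_assoc)
  finally show ?thesis
    using state_peak[OF k a x y] right[OF x] x y c by (simp add: TA.m_assoc)
qed

text \<open>
  The factors next to a peak have smaller indices, so the products before and after the peak absorb
  the cut at its index or are empty.
\<close>

lemma state_list_product_peak:
  assumes js: "set js \<subseteq> J"
    and bs: "list_all2 (\<lambda>j b. b \<in> {replica J A j a | a. a \<in> carrier (A j)}) js bs"
    and peak: "local_peak js i"
  shows "\<exists>a\<in>carrier (A (js ! i)). bs ! i = replica J A (js ! i) a \<and>
    pst (list_product TA bs) = (\<chi> (js ! i) a - \<omega> (js ! i) a) * pst (list_product TA (take i bs))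
        * pst (list_product TA (drop (Suc i) bs))
      + \<omega> (js ! i) a * pst (list_product TA (take i bs @ drop (Suc i) bs))"
proof -
  let ?k = "js ! i" and ?x = "list_product TA (take i bs)" and ?y = "list_product TA (drop (Suc i) bs)"
  have len: "length js = length bs" using bs by (rule list_all2_lengthD)
  have i: "i < length bs" using peak len by (simp add: local_peak_def)
  have J: "js ! l \<in> J" if "l < length bs" for l
    using that js len by (metis nth_mem subsetD)
  have replicas: "\<exists>a\<in>carrier (A (js ! l)). bs ! l = replica J A (js ! l) a" if "l < length bs" for l
    using list_all2_nthD2[OF bs that] by blast
  have carrier: "set bs \<subseteq> carrier TA"
  proof
    fix b assume "b \<in> set bs"
    then obtain l where "l < length bs" "b = bs ! l" by (metis in_set_conv_nth)
    then show "b \<in> carrier TA" using replicas[of l] J[of l] by auto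
  qed
  then have parts: "set (take i bs) \<subseteq> carrier TA" "set (drop (Suc i) bs) \<subseteq> carrier TA"
    by (meson set_take_subset set_drop_subset subset_trans)+
  have x: "?x \<in> carrier TA" and y: "?y \<in> carrier TA" using parts by (auto intro: TA.list_product_closed)
  obtain a where a: "a \<in> carrier (A ?k)" "bs ! i = replica J A ?k a" using replicas[OF i] by blast
  have k: "?k \<in> J" by (rule J[OF i])
  have x_cut: "?x = \<one>\<^bsub>TA\<^esub> \<or> ?x \<otimes>\<^bsub>TA\<^esub> cut ?k = ?x"
  proof (cases i)
    case (Suc l)
    then have l: "l < length bs" "js ! l < ?k" using i peak by (auto simp: local_peak_def)
    obtain b where b: "b \<in> carrier (A (js ! l))" "bs ! l = replica J A (js ! l) b"
      using replicas[OF l(1)] by blast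
    have "take i bs = take l bs @ [bs ! l]" using l Suc by (simp add: take_Suc_conv_app_nth)
    moreover have "set (take l bs) \<subseteq> carrier TA" "bs ! l \<in> carrier TA"
      using carrier l by (auto dest: in_set_takeD)
    ultimately have "?x = list_product TA (take l bs) \<otimes>\<^bsub>TA\<^esub> bs ! l"
      and "list_product TA (take l bs) \<in> carrier TA"
      by (auto simp: TA.list_product_append intro: TA.list_product_closed)
    then show ?thesis
      using replica_cut(1)[OF J[OF l(1)] k l(2) b(1)] b J[OF l(1)] k by (simp add: TA.m_assoc)
  qed simp
  have y_cut: "?y = \<one>\<^bsub>TA\<^esub> \<or> cut ?k \<otimes>\<^bsub>TA\<^esub> ?y = ?y"
  proof (cases "Suc i < length bs")
    case True
    then have l: "js ! Suc i < ?k" using peak len by (simp add: local_peak_def)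
    obtain b where b: "b \<in> carrier (A (js ! Suc i))" "bs ! Suc i = replica J A (js ! Suc i) b"
      using replicas[OF True] by blast
    have "drop (Suc i) bs = bs ! Suc i # drop (Suc (Suc i)) bs"
      using True by (simp add: Cons_nth_drop_Suc)
    moreover have "set (drop (Suc (Suc i)) bs) \<subseteq> carrier TA"
      using carrier by (meson set_drop_subset subset_trans)
    ultimately have "?y = bs ! Suc i \<otimes>\<^bsub>TA\<^esub> list_product TA (drop (Suc (Suc i)) bs)"
      and "list_product TA (drop (Suc (Suc i)) bs) \<in> carrier TA"
      by (auto intro: TA.list_product_closed)
    then show ?thesis
      using replica_cut(2)[OF J[OF True] k l b(1)] b J[OF True] k
      by (simp add: TA.m_assoc[symmetric])
  qed simp
  have "bs = take i bs @ bs ! i # drop (Suc i) bs" using i by (simp add: id_take_nth_drop)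
  moreover have "bs ! i \<in> carrier TA" using a k by simp
  ultimately have "list_product TA bs = ?x \<otimes>\<^bsub>TA\<^esub> (replica J A ?k a \<otimes>\<^bsub>TA\<^esub> ?y)"
    using TA.list_product_append[of "take i bs" "bs ! i # drop (Suc i) bs"] parts a
    by simp
  moreover have "list_product TA (take i bs @ drop (Suc i) bs) = ?x \<otimes>\<^bsub>TA\<^esub> ?y"
    by (rule TA.list_product_append[OF parts])
  ultimately show ?thesis
    using state_peak_product[OF k a(1) x y x_cut y_cut] a by (intro bexI[of _ a]) auto
qed

end

section \<open>C-monotone independence of the replicas\<close>

theorem theorem3p1:
  fixes J :: "'j::linorder set"
    and A :: "'j \<Rightarrow> (complex, 'a) module"
    and \<phi> \<psi> :: "'j \<Rightarrow> 'a \<Rightarrow> complex"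
  assumes "\<And>j. j \<in> J \<Longrightarrow> complex_algebra (A j)"
    and "\<And>j. j \<in> J \<Longrightarrow> state (A j) (\<phi> j)"
    and "\<And>j. j \<in> J \<Longrightarrow> state (A j) (\<psi> j)"
  shows "c_monotone_independent (big_algebra J A) (big_state J A \<phi> \<psi>) (big_state J A \<psi> \<psi>) J
           (\<lambda>j. generated_subalgebra (big_algebra J A) {replica J A j a | a. a \<in> carrier (A j)})"
proof -
  interpret algebra_family J A
    by (rule algebra_family.intro) (use assms(1) complex_algebra_iff in blast)
  interpret \<phi>: algebra_family_with_states J A \<phi> \<psi>
    by (intro algebra_family_with_states.intro algebra_family_axioms
        algebra_family_with_states_axioms.intro assms(2,3))
  interpret \<psi>: algebra_family_with_states J A \<psi> \<psi>
    by (intro algebra_family_with_states.intro algebra_family_axioms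
        algebra_family_with_states_axioms.intro assms(3))
  let ?B = "\<lambda>j. generated_subalgebra (big_algebra J A) {replica J A j a | a. a \<in> carrier (A j)}"
  let ?\<phi> = "big_state J A \<phi> \<psi>" and ?\<psi> = "big_state J A \<psi> \<psi>"
  have B: "?B j = {replica J A j a | a. a \<in> carrier (A j)}" if "j \<in> J" for j
    using generated_subalgebra_replicas[OF that] by (simp add: big_algebra_eq)
  have members: "list_all2 (\<lambda>j b. b \<in> {replica J A j a | a. a \<in> carrier (A j)}) js bs"
    if "set js \<subseteq> J" "list_all2 (\<lambda>j b. b \<in> ?B j) js bs" for js bs
    by (rule list.rel_mono_strong[OF that(2)]) (use that(1) B in blast)
  have "complex_algebra TA"
    using TA.ring_over_complex_axioms by (simp add: complex_algebra_iff)
  moreover have "?\<psi> (list_product TA bs) = ?\<psi> (bs ! i) * ?\<psi> (list_product TA (take i bs @ drop (Suc i) bs))"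
    if js: "set js \<subseteq> J" and bs: "list_all2 (\<lambda>j b. b \<in> ?B j) js bs" and peak: "local_peak js i" for js bs i
  proof -
    have "js ! i \<in> J" using js peak by (auto simp: local_peak_def)
    then show ?thesis
      using \<psi>.state_list_product_peak[OF js members[OF js bs] peak] \<psi>.state_replica
      by (auto simp: \<psi>.big_state_eq)
  qed
  moreover have "?\<phi> (list_product TA bs)
      = (?\<phi> (bs ! i) - ?\<psi> (bs ! i)) * ?\<phi> (list_product TA (take i bs))
          * ?\<phi> (list_product TA (drop (Suc i) bs))
        + ?\<psi> (bs ! i) * ?\<phi> (list_product TA (take i bs @ drop (Suc i) bs))"
    if js: "set js \<subseteq> J" and bs: "list_all2 (\<lambda>j b. b \<in> ?B j) js bs" and peak: "local_peak js i" for js bs i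
  proof -
    have "js ! i \<in> J" using js peak by (auto simp: local_peak_def)
    then show ?thesis
      using \<phi>.state_list_product_peak[OF js members[OF js bs] peak] \<phi>.state_replica \<psi>.state_replica
      by (auto simp: \<phi>.big_state_eq \<psi>.big_state_eq)
  qed
  moreover have "complex_subalgebra (?B j) TA" if "j \<in> J" for j
    using replica_subalgebra[OF that] by (simp add: B that)
  ultimately show ?thesis
    using \<phi>.state_product_state \<psi>.state_product_state
    unfolding c_monotone_independent_def monotone_independent_def big_algebra_eq
      \<phi>.big_state_eq \<psi>.big_state_eq
    by blast
qed

end
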